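(* Let $\mathcal{G} = (\mathcal{V}, \mathcal{E}, |\cdot|)$ be an (infinite) tessellating metric graph having infinite volume, $\mathrm{mes}(\mathcal{G}) = \sum_{e\in\mathcal{E}}|e|=\infty$. If $$\ell^\ast(\mathcal{G}):= \sup_{e \in \mathcal{E}} |e| < \infty$$ and $$\liminf_{\mathrm{mes}(\widetilde{\mathcal{G}}) \to \infty} \frac{1}{\mathrm{mes}(\widetilde{\mathcal{G}})}\sum_{e \in \widetilde{\mathcal{E}}} c(e)\, |e| = \liminf_{\mathrm{mes}(\widetilde{\mathcal{G}}) \to \infty} \frac{\sum_{e \in \widetilde{\mathcal{E}}} c(e) |e|}{\sum_{e \in \widetilde{\mathcal{E}}} |e|} > 0,$$ where the $\liminf$ is taken over all star-like complete subgraphs $\widetilde{\mathcal{G}} = (\widetilde{\mathcal{V}},\widetilde{\mathcal{E}})\in\mathcal{S}(\mathcal{G})$, then the isoperimetric constant satisfies $\alpha(\mathcal{G}) >0$.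
   Context: **Tessellating graphs.** $\mathcal{G}_d = (\mathcal{V}, \mathcal{E})$ is an unoriented graph with countably infinite vertex set $\mathcal{V}$ and edge set $\mathcal{E}$; it is connected, simple (no loops or multiple edges) and locally finite. For $v\in\mathcal{V}$, $\mathcal{E}_v$ is the set of edges incident to $v$ and $\deg(v)=\#\mathcal{E}_v<\infty$. The graph is planar with a fixed planar embedding, so that $\mathcal{G}_d$ is regarded as a subset of $\mathbb{R}^2$, assumed closed. $\mathcal{T}$ is the set of faces (called tiles), i.e. the closures of the connected components of $\mathbb{R}^2\setminus\mathcal{G}_d$ (unbounded ones included). $\mathcal{G}_d$ is *tessellating* if: (i) $\mathcal{T}$ is locally finite: each compact subset of $\mathbb{R}^2$ intersects only finitely many tiles; (ii) each bounded tile $T$ is a closed topological disc and $\partial T$ consists of a finite cycle of at least three edges; (iii) each unbounded tile $T$ is a closed topological half-plane and $\partial T$ consists of a (countably) infinite chain of edges; (iv) each edge is contained in the boundary of precisely two different tiles; (v) each vertex has degree $\ge 3$. Here a closed topological disc (half-plane) is the image of the closed unit ball of $\mathbb{R}^2$ (closed upper half-plane) under a homeomorphism $\mathbb{R}^2\to\mathbb{R}^2$. For $T\in\mathcal{T}$ let $\mathcal{E}_T=\{e\in\mathcal{E} : e\subseteq\partial T\}$. **Metric graph.** A tessellating metric graph $\mathcal{G}=(\mathcal{V},\mathcal{E},|\cdot|)$ is a tessellating graph $\mathcal{G}_d$ together with a length $|e|\in(0,\infty)$ for each edge $e$. For a subgraph $\widetilde{\mathcal{G}}=(\widetilde{\mathcal{V}},\widetilde{\mathcal{E}})$,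 $\mathrm{mes}(\widetilde{\mathcal{G}})=\sum_{e\in\widetilde{\mathcal{E}}}|e|$, and its boundary vertices are $\partial_{\mathcal{G}}\widetilde{\mathcal{G}}=\{v\in\widetilde{\mathcal{V}} : \deg_{\widetilde{\mathcal{G}}}(v)<\deg(v)\}$, where $\deg_{\widetilde{\mathcal{G}}}$ is the degree in $\widetilde{\mathcal{G}}$. For finite $\widetilde{\mathcal{G}}$, $\deg(\partial_{\mathcal{G}}\widetilde{\mathcal{G}})=\sum_{v\in\partial_{\mathcal{G}}\widetilde{\mathcal{G}}}\deg_{\widetilde{\mathcal{G}}}(v)$. **Isoperimetric constant.** $$\alpha(\mathcal{G})=\inf_{\widetilde{\mathcal{G}}}\frac{\deg(\partial_{\mathcal{G}}\widetilde{\mathcal{G}})}{\mathrm{mes}(\widetilde{\mathcal{G}})}\in[0,\infty),$$ the infimum over all finite connected subgraphs $\widetilde{\mathcal{G}}\subset\mathcal{G}$ (with at least one edge). **Characteristic values.** For $v\in\mathcal{V}$, $m(v)=\sum_{e\in\mathcal{E}_v}|e|$. For $T\in\mathcal{T}$, $p(T)=\sum_{e\in\mathcal{E}_T}|e|$ if $T$ is bounded and $p(T)=\infty$ if $T$ is unbounded. For $e\in\mathcal{E}$, $$c(e)=\frac1{|e|}-\sum_{v: v\in e}\frac1{m(v)}-\sum_{T: e\subseteq\partial T}\frac1{p(T)},$$ the sums being over the two endpoints of $e$ and the two tiles containing $e$ in their boundary, with the convention $1/\infty=0$. **Star-like complete subgraphs.** A subgraph $\widetilde{\mathcal{G}}=(\widetilde{\mathcal{V}},\widetilde{\mathcal{E}})$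 is *star-like* if $\widetilde{\mathcal{E}}=\bigcup_{v\in\widetilde U}\mathcal{E}_v$ for some finite connected vertex set $\widetilde U\subseteq\widetilde{\mathcal{V}}$. The *interior graph* $\widetilde{\mathcal{G}}_{\mathrm{int}}$ of a finite subgraph $\widetilde{\mathcal{G}}$ has vertex set $\widetilde{\mathcal{V}}\setminus\partial_{\mathcal{G}}\widetilde{\mathcal{G}}$ and all edges between such vertices. For a finite subgraph $\mathcal{H}$, $\mathcal{F}(\mathcal{H})$ is the set of closures of bounded connected components of $\mathbb{R}^2\setminus\mathcal{H}$ (bounded faces), and $\mathcal{P}(\mathcal{H})$ is the set of tiles $T\in\mathcal{T}$ with $\partial T\subseteq\mathcal{H}$. A finite subgraph $\widetilde{\mathcal{G}}$ is *complete* if $\mathcal{F}(\widetilde{\mathcal{G}}_{\mathrm{int}})=\mathcal{P}(\widetilde{\mathcal{G}}_{\mathrm{int}})$, i.e. every bounded face of $\widetilde{\mathcal{G}}_{\mathrm{int}}$ consists of exactly one tile. $\mathcal{S}(\mathcal{G})$ denotes the class of star-like complete subgraphs. The $\liminf$ as $\mathrm{mes}(\widetilde{\mathcal{G}})\to\infty$ of a quantity $f(\widetilde{\mathcal{G}})$ over $\mathcal{S}(\mathcal{G})$ means $\lim_{r\to\infty}\inf\{f(\widetilde{\mathcal{G}}) : \widetilde{\mathcal{G}}\in\mathcal{S}(\mathcal{G}),\ \mathrm{mes}(\widetilde{\mathcal{G}})\ge r\}$. *)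

theory Defs
  imports "HOL-Analysis.Analysis"
begin

text \<open>
  The plane is the type \<^typ>\<open>complex\<close>. A graph drawn in the plane is identified with its drawing:
  vertices are points and edges are point sets (closed arcs including their endpoints), so that an
  edge \<open>e\<close> has the endpoints \<open>e \<inter> verts G\<close>, and \<open>v \<in> e\<close> is incidence. Subgraphs are graphs of the
  same type.
\<close>

record plane_graph =
  verts :: "complex set"
  edges :: "complex set set"

definition support :: "plane_graph \<Rightarrow> complex set" where
  "support G = verts G \<union> \<Union>(edges G)"

definition star :: "plane_graph \<Rightarrow> complex \<Rightarrow> complex set set" where
  "star G v = {e \<in> edges G. v \<in> e}"

definition deg :: "plane_graph \<Rightarrow> complex \<Rightarrow> nat" where
  "deg G v = card (star G v)"

definition adjacent :: "plane_graph \<Rightarrow> complex \<Rightarrow> complex \<Rightarrow> bool" where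
  "adjacent G u v \<longleftrightarrow> (\<exists>e\<in>edges G. e \<inter> verts G = {u, v})"

definition connected_graph :: "plane_graph \<Rightarrow> bool" where
  "connected_graph G \<longleftrightarrow>
     verts G \<noteq> {} \<and> (\<forall>u\<in>verts G. \<forall>v\<in>verts G. (adjacent G)\<^sup>*\<^sup>* u v)"

definition induced :: "plane_graph \<Rightarrow> complex set \<Rightarrow> plane_graph" where
  "induced G U = \<lparr>verts = U, edges = {e \<in> edges G. e \<inter> verts G \<subseteq> U}\<rparr>"

definition subgraph :: "plane_graph \<Rightarrow> plane_graph \<Rightarrow> bool" where
  "subgraph H G \<longleftrightarrow>
     verts H \<subseteq> verts G \<and> edges H \<subseteq> edges G \<and> (\<forall>e\<in>edges H. e \<inter> verts G \<subseteq> verts H)"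

definition finite_subgraph :: "plane_graph \<Rightarrow> plane_graph \<Rightarrow> bool" where
  "finite_subgraph H G \<longleftrightarrow> subgraph H G \<and> finite (verts H) \<and> finite (edges H)"

text \<open>
  Loops are excluded because an \<^const>\<open>arc\<close> has two distinct endpoints; the last assumption
  excludes multiple edges.
\<close>

locale simple_plane_graph =
  fixes G :: plane_graph
  assumes edge_arc: "e \<in> edges G \<Longrightarrow>
      \<exists>g. arc g \<and> path_image g = e \<and> e \<inter> verts G = {pathstart g, pathfinish g}"
    and edges_meet_in_verts: "\<lbrakk>e \<in> edges G; e' \<in> edges G; e \<noteq> e'\<rbrakk> \<Longrightarrow> e \<inter> e' \<subseteq> verts G"
    and no_multiple_edges:
      "\<lbrakk>e \<in> edges G; e' \<in> edges G; e \<inter> verts G = e' \<inter> verts G\<rbrakk> \<Longrightarrow> e = e'"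

definition tiles :: "plane_graph \<Rightarrow> complex set set" where
  "tiles G = closure ` components (- support G)"

definition closed_topological_disc :: "complex set \<Rightarrow> bool" where
  "closed_topological_disc T \<longleftrightarrow> (\<exists>(h :: complex \<Rightarrow> complex) h'. homeomorphism UNIV UNIV h h' \<and> T = h ` cball 0 1)"

definition closed_topological_half_plane :: "complex set \<Rightarrow> bool" where
  "closed_topological_half_plane T \<longleftrightarrow>
     (\<exists>(h :: complex \<Rightarrow> complex) h'. homeomorphism UNIV UNIV h h' \<and> T = h ` {z. Im z \<ge> 0})"

definition consists_of_finite_cycle :: "plane_graph \<Rightarrow> complex set \<Rightarrow> bool" where
  "consists_of_finite_cycle G X \<longleftrightarrow>
     (\<exists>n v e. 3 \<le> n \<and> inj_on v {..<n} \<and>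
        (\<forall>i<n. e i \<in> edges G \<and> e i \<inter> verts G = {v i, v (Suc i mod n)}) \<and>
        X = (\<Union>i<n. e i))"

text \<open>
  The chain is infinite in both directions, since the boundary of a closed topological half-plane
  is a topological line.
\<close>

definition consists_of_infinite_chain :: "plane_graph \<Rightarrow> complex set \<Rightarrow> bool" where
  "consists_of_infinite_chain G X \<longleftrightarrow>
     (\<exists>(v :: int \<Rightarrow> complex) e. inj v \<and>
        (\<forall>i. e i \<in> edges G \<and> e i \<inter> verts G = {v i, v (i + 1)}) \<and>
        X = (\<Union>i. e i))"

locale tessellating_graph = simple_plane_graph +
  assumes countable_verts: "countable (verts G)"
    and infinite_verts: "infinite (verts G)"
    and connected: "connected_graph G"
    and locally_finite: "v \<in> verts G \<Longrightarrow> finite (star G v)"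
    and closed_support: "closed (support G)"
    and tiles_locally_finite: "compact K \<Longrightarrow> finite {T \<in> tiles G. T \<inter> K \<noteq> {}}"
    and bounded_tile: "\<lbrakk>T \<in> tiles G; bounded T\<rbrakk> \<Longrightarrow>
      closed_topological_disc T \<and> consists_of_finite_cycle G (frontier T)"
    and unbounded_tile: "\<lbrakk>T \<in> tiles G; \<not> bounded T\<rbrakk> \<Longrightarrow>
      closed_topological_half_plane T \<and> consists_of_infinite_chain G (frontier T)"
    and edge_in_two_tiles: "e \<in> edges G \<Longrightarrow> card {T \<in> tiles G. e \<subseteq> frontier T} = 2"
    and deg_ge_3: "v \<in> verts G \<Longrightarrow> 3 \<le> deg G v"

locale tessellating_metric_graph = tessellating_graph +
  fixes len :: "complex set \<Rightarrow> real"
  assumes len_pos: "e \<in> edges G \<Longrightarrow> 0 < len e"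

definition mes :: "(complex set \<Rightarrow> real) \<Rightarrow> plane_graph \<Rightarrow> ereal" where
  "mes len H = (\<Sum>\<^sub>\<infinity>e\<in>edges H. ereal (len e))"

definition boundary_verts :: "plane_graph \<Rightarrow> plane_graph \<Rightarrow> complex set" where
  "boundary_verts G H = {v \<in> verts H. deg H v < deg G v}"

definition boundary_deg :: "plane_graph \<Rightarrow> plane_graph \<Rightarrow> nat" where
  "boundary_deg G H = (\<Sum>v\<in>boundary_verts G H. deg H v)"

definition isoperimetric_constant :: "plane_graph \<Rightarrow> (complex set \<Rightarrow> real) \<Rightarrow> ereal" where
  "isoperimetric_constant G len =
     (INF H \<in> {H. finite_subgraph H G \<and> connected_graph H \<and> edges H \<noteq> {}}.
        ereal (real (boundary_deg G H)) / mes len H)"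

definition vertex_weight :: "plane_graph \<Rightarrow> (complex set \<Rightarrow> real) \<Rightarrow> complex \<Rightarrow> real" where
  "vertex_weight G len v = (\<Sum>e\<in>star G v. len e)"

definition tile_perimeter :: "plane_graph \<Rightarrow> (complex set \<Rightarrow> real) \<Rightarrow> complex set \<Rightarrow> ereal" where
  "tile_perimeter G len T =
     (if bounded T then ereal (\<Sum>e\<in>{e \<in> edges G. e \<subseteq> frontier T}. len e) else \<infinity>)"

definition characteristic_value :: "plane_graph \<Rightarrow> (complex set \<Rightarrow> real) \<Rightarrow> complex set \<Rightarrow> real" where
  "characteristic_value G len e =
     1 / len e
     - (\<Sum>v\<in>e \<inter> verts G. 1 / vertex_weight G len v)
     - (\<Sum>T\<in>{T \<in> tiles G. e \<subseteq> frontier T}. real_of_ereal (1 / tile_perimeter G len T))"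

definition star_like :: "plane_graph \<Rightarrow> plane_graph \<Rightarrow> bool" where
  "star_like G H \<longleftrightarrow>
     (\<exists>U. finite U \<and> U \<subseteq> verts H \<and> connected_graph (induced G U) \<and>
          edges H = (\<Union>v\<in>U. star G v))"

definition interior_graph :: "plane_graph \<Rightarrow> plane_graph \<Rightarrow> plane_graph" where
  "interior_graph G H = induced H (verts H - boundary_verts G H)"

definition bounded_faces :: "plane_graph \<Rightarrow> complex set set" where
  "bounded_faces H = closure ` {C \<in> components (- support H). bounded C}"

definition tiles_bounded_by :: "plane_graph \<Rightarrow> plane_graph \<Rightarrow> complex set set" where
  "tiles_bounded_by G H = {T \<in> tiles G. frontier T \<subseteq> support H}"

definition complete_subgraph :: "plane_graph \<Rightarrow> plane_graph \<Rightarrow> bool" where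
  "complete_subgraph G H \<longleftrightarrow>
     bounded_faces (interior_graph G H) = tiles_bounded_by G (interior_graph G H)"

definition star_like_complete_subgraphs :: "plane_graph \<Rightarrow> plane_graph set" where
  "star_like_complete_subgraphs G =
     {H. finite_subgraph H G \<and> star_like G H \<and> complete_subgraph G H}"

definition liminf_mes ::
  "plane_graph \<Rightarrow> (complex set \<Rightarrow> real) \<Rightarrow> (plane_graph \<Rightarrow> ereal) \<Rightarrow> ereal" where
  "liminf_mes G len f =
     Lim at_top (\<lambda>r::real. INF H \<in> {H \<in> star_like_complete_subgraphs G. ereal r \<le> mes len H}. f H)"

text \<open>The limit always exists, by monotonicity.\<close>

lemma liminf_mes_eq_SUP:
  "liminf_mes G len f =
     (SUP r::real. INF H \<in> {H \<in> star_like_complete_subgraphs G. ereal r \<le> mes len H}. f H)"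
proof -
  define g where
    "g r = (INF H \<in> {H \<in> star_like_complete_subgraphs G. ereal r \<le> mes len H}. f H)" for r :: real
  have mono: "g r \<le> g s" if "r \<le> s" for r s
  proof -
    have "ereal r \<le> mes len H" if "ereal s \<le> mes len H" for H
      using \<open>r \<le> s\<close> that by (meson ereal_less_eq(3) order_trans)
    then show ?thesis
      unfolding g_def by (intro INF_superset_mono) blast+
  qed
  have "(g \<longlongrightarrow> (SUP r. g r)) at_top"
  proof (rule increasing_tendsto)
    show "\<forall>\<^sub>F r in at_top. g r \<le> (SUP r. g r)"
      by (simp add: SUP_upper)
  next
    fix x assume "x < (SUP r. g r)"
    then obtain r where "x < g r"
      by (auto simp: less_SUP_iff)
    then have "\<forall>s\<ge>r. x < g s"
      using mono less_le_trans by blast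
    then show "\<forall>\<^sub>F r in at_top. x < g r"
      unfolding eventually_at_top_linorder by blast
  qed
  then have "Lim at_top g = (SUP r. g r)"
    by (rule tendsto_Lim[OF trivial_limit_at_top_linorder])
  then show ?thesis
    unfolding liminf_mes_def g_def .
qed

end

theory Submission
  imports Defs
begin

text \<open>
  Write \<open>\<partial>U\<close> for the set of edges with exactly one end in a vertex set \<open>U\<close>. A finite connected \<open>U\<close> is
  contained in a finite connected \<open>W\<close> minimizing \<open>card (\<partial>W)\<close> among the finite connected supersets.
  Adding to \<open>W\<close> the vertices in bounded faces, or a vertex all of whose neighbours lie in \<open>W\<close>, would
  shrink \<open>\<partial>W\<close>. Hence there are none, the star-like subgraph around \<open>W\<close> is complete, and its interior
  graph is the subgraph induced by \<open>W\<close>. In the sum of \<open>c(e) |e|\<close> over this star-like subgraph every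
  vertex of \<open>W\<close> and every bounded face of the interior graph accounts for \<open>-1\<close>, so Euler's
  inequality bounds the sum by \<open>card (\<partial>W)\<close>. The hypothesis on the limes inferior thus yields
  \<open>card (\<partial>W) \<ge> \<delta> mes\<close>, a bound inherited by \<open>U\<close>, and by finite vertex sets that need not be
  connected. For an arbitrary finite subgraph take \<open>U\<close> to be its interior vertices; its remaining
  edges are controlled by the degree of the boundary and the supremum of the lengths.
\<close>

section \<open>Complements of arcs in the plane\<close>

text \<open>Invariance of dimension: the inverse of the parametrization would embed a nonempty open
  set of dimension at least \<open>2\<close> into the real line.\<close>

lemma interior_arc_image:
  fixes g :: "real \<Rightarrow> 'a::euclidean_space"
  assumes "arc g" and "2 \<le> DIM('a)"
  shows "interior (path_image g) = {}"
proof (rule ccontr)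
  assume ne: "interior (path_image g) \<noteq> {}"
  obtain h where h: "homeomorphism {0..1} (path_image g) g h"
    using homeomorphism_arc[OF assms(1)] .
  have sub: "interior (path_image g) \<subseteq> path_image g"
    by (rule interior_subset)
  have "continuous_on (interior (path_image g)) h"
    using h sub by (meson continuous_on_subset homeomorphism_def)
  moreover have "inj_on h (interior (path_image g))"
    using inj_on_inverseI[of "path_image g" g h] homeomorphism_apply2[OF h] sub
    by (blast intro: inj_on_subset)
  ultimately have "DIM('a) \<le> DIM(real)"
    using invariance_of_dimension[of "interior (path_image g)" h] ne by auto
  then show False using assms(2) by simp
qed

lemma interior_Union_closed_empty:
  assumes "finite F" "\<And>S. S \<in> F \<Longrightarrow> closed S \<and> interior S = {}"
  shows "interior (\<Union>F) = {}"
  using assms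
proof (induction F)
  case (insert S F)
  have "interior (S \<union> \<Union>F) = interior S"
    by (rule interior_closed_Un_empty_interior) (use insert in auto)
  with insert show ?case by simp
qed simp

text \<open>Finiteness has to be tracked, since \<^const>\<open>card\<close> of an infinite set is \<open>0\<close>.\<close>

lemma components_dense_subset:
  fixes A B :: "'a::real_normed_vector set"
  assumes "open B" "A \<subseteq> B" "B \<subseteq> closure A" and fin: "finite (components A)"
  shows "finite (components B)"
    and "\<lbrakk>a \<in> A; b \<in> A; connected_component B a b; \<not> connected_component A a b\<rbrakk>
           \<Longrightarrow> card (components B) < card (components A)"
proof -
  \<comment> \<open>\<open>\<phi>\<close> sends a component of \<open>A\<close> to the component of
    \<open>B\<close> around it. The chosen point is immaterial, as the first fact about
    \<open>\<phi>\<close> shows.\<close>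
  define \<phi> where "\<phi> D = connected_component_set B (SOME x. x \<in> D)" for D
  have \<phi>: "\<phi> (connected_component_set A x) = connected_component_set B x" if "x \<in> A" for x
  proof -
    have "x \<in> connected_component_set A x"
      using that by simp
    then have "(SOME y. y \<in> connected_component_set A x) \<in> connected_component_set A x"
      by (rule someI)
    also have "\<dots> \<subseteq> connected_component_set B x"
      by (rule connected_component_mono[OF \<open>A \<subseteq> B\<close>])
    finally show ?thesis
      unfolding \<phi>_def by (rule connected_component_eq)
  qed
  \<comment> \<open>Surjectivity comes from density: each component of the open set \<open>B\<close>
    is open and therefore meets \<open>A\<close>.\<close>
  have img: "components B = \<phi> ` components A"
  proof (intro equalityI subsetI)
    fix C assume C: "C \<in> components B"
    have "open C" "C \<noteq> {}"
      using C \<open>open B\<close> by (auto simp: open_components in_components_nonempty)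
    moreover have "C \<subseteq> closure A"
      using C assms(3) in_components_subset by blast
    ultimately have "C \<inter> A \<noteq> {}"
      using open_Int_closure_eq_empty[of C A] by blast
    then obtain x where x: "x \<in> C" "x \<in> A"
      by blast
    from C obtain y where "C = connected_component_set B y"
      by (auto simp: components_def)
    with x(1) have "C = \<phi> (connected_component_set A x)"
      using \<phi>[OF x(2)] connected_component_eq[of x B y] by simp
    then show "C \<in> \<phi> ` components A"
      using componentsI[OF x(2)] by blast
  next
    fix C assume "C \<in> \<phi> ` components A"
    then obtain x where "x \<in> A" "C = connected_component_set B x"
      using \<phi> by (auto simp: components_def)
    then show "C \<in> components B"
      using \<open>A \<subseteq> B\<close> by (auto intro: componentsI)
  qed
  show "finite (components B)"
    unfolding img using fin by (rule finite_imageI)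
  assume ab: "a \<in> A" "b \<in> A" "connected_component B a b" "\<not> connected_component A a b"
  \<comment> \<open>The components of \<open>a\<close> and \<open>b\<close> are distinct in
    \<open>A\<close> but have the same image, so the surjection \<open>\<phi>\<close> loses at least
    one element.\<close>
  have "\<not> inj_on \<phi> (components A)"
  proof
    assume inj: "inj_on \<phi> (components A)"
    have "\<phi> (connected_component_set A a) = \<phi> (connected_component_set A b)"
      using ab \<phi> connected_component_eq[of b B a] by simp
    then have "connected_component_set A a = connected_component_set A b"
      using inj_onD[OF inj] componentsI ab by blast
    moreover have "b \<in> connected_component_set A b"
      using ab by simp
    ultimately show False
      using ab by blast
  qed
  then show "card (components B) < card (components A)"
    unfolding img using card_image_le[OF fin, of \<phi>] eq_card_imp_inj_on[OF fin, of \<phi>] by linarith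
qed

text \<open>
  The arc closes up to a Jordan curve, both sides of which are met by every neighbourhood of an
  inner point of the arc.
\<close>

lemma arc_separates:
  fixes S :: "complex set"
  assumes "closed S" "arc g" and disj: "path_image g \<inter> S = {pathstart g, pathfinish g}"
    and pc: "path_component S (pathfinish g) (pathstart g)"
  obtains a b where "a \<in> - (S \<union> path_image g)" "b \<in> - (S \<union> path_image g)"
    "connected_component (- S) a b" "\<not> connected_component (- (S \<union> path_image g)) a b"
proof -
  obtain q where q: "path q" "path_image q \<subseteq> S" "pathstart q = pathfinish g" "pathfinish q = pathstart g"
    using pc unfolding path_component_def by auto
  have "pathfinish g \<noteq> pathstart g"
    using \<open>arc g\<close> arc_distinct_ends by metis
  \<comment> \<open>The return path in \<open>S\<close> is replaced by an arc, so that the closed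
    curve becomes simple.\<close>
  with q obtain h where h: "arc h" "path_image h \<subseteq> S" "pathstart h = pathfinish g" "pathfinish h = pathstart g"
    using path_contains_arc by (metis order_trans)
  define J where "J = path_image (g +++ h)"
  have J: "J = path_image g \<union> path_image h"
    unfolding J_def using h by (simp add: path_image_join)
  have "simple_path (g +++ h)"
    using h assms by (intro simple_path_join_loop) auto
  then have Jo: "open (inside J)" "open (outside J)" "inside J \<inter> outside J = {}"
    "inside J \<union> outside J = - J" "frontier (inside J) = J" "frontier (outside J) = J"
    unfolding J_def using Jordan_inside_outside[of "g +++ h"] h by auto
  \<comment> \<open>Any inner point of the arc would do. It avoids \<open>S\<close>, which the arc
    meets only at its ends, so a small ball around it lies in one component of
    \<open>- S\<close>.\<close>
  define p where "p = g (1/2)"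
  have p: "p \<in> path_image g"
    unfolding p_def path_image_def by simp
  have "p \<noteq> g 0" "p \<noteq> g 1"
    unfolding p_def using \<open>arc g\<close> by (auto simp: arc_def dest: inj_onD[of g _ "1/2"])
  with p disj have "p \<in> - S"
    unfolding pathstart_def pathfinish_def by blast
  then obtain r where r: "r > 0" "ball p r \<subseteq> - S"
    using \<open>closed S\<close> by (meson open_Compl open_contains_ball)
  have "p \<in> J" using p J by simp
  then have "p \<in> closure (inside J)" "p \<in> closure (outside J)"
    using Jo by (auto simp: frontier_def)
  then obtain a b where a: "a \<in> inside J" "dist a p < r" and b: "b \<in> outside J" "dist b p < r"
    using r by (meson closure_approachable)
  have ab: "a \<in> ball p r" "b \<in> ball p r"
    using a b by (auto simp: dist_commute)
  have conn: "connected_component (- S) a b"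
    using ab r by (meson connected_ball connected_component_def)
  have notJ: "a \<notin> J" "b \<notin> J"
    using a b inside_no_overlap[of J] outside_no_overlap[of J] by blast+
  have mem: "a \<in> - (S \<union> path_image g)" "b \<in> - (S \<union> path_image g)"
    using ab r notJ J by auto
  have "\<not> connected_component (- (S \<union> path_image g)) a b"
  proof
    assume "connected_component (- (S \<union> path_image g)) a b"
    then obtain T where T: "connected T" "T \<subseteq> - (S \<union> path_image g)" "a \<in> T" "b \<in> T"
      by (auto simp: connected_component_def)
    have "T \<subseteq> inside J \<union> outside J"
      using T(2) h(2) J Jo(4) by auto
    then show False
      using connectedD[OF T(1) Jo(1,2)] Jo(3) T a b by blast
  qed
  with mem conn show thesis by (rule that)
qed

text \<open>Faces are closures of components. Injectivity allows faces and components to be counted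
  interchangeably.\<close>

lemma inj_on_closure_components:
  fixes S :: "'a::real_normed_vector set"
  assumes "open S"
  shows "inj_on closure (components S)"
proof (rule inj_onI)
  fix C D assume C: "C \<in> components S" and D: "D \<in> components S" and eq: "closure C = closure D"
  have "open D" "D \<noteq> {}"
    using D assms by (auto simp: open_components in_components_nonempty)
  moreover have "D \<subseteq> closure C"
    using eq closure_subset by blast
  ultimately have "D \<inter> C \<noteq> {}"
    using open_Int_closure_eq_empty[of D C] by blast
  then show "C = D"
    using components_eq[OF C D] by blast
qed

section \<open>Euler's inequality for plane graphs\<close>

lemma rtranclp_exit:
  assumes "R\<^sup>*\<^sup>* a b" "a \<in> S" "b \<notin> S"
  obtains x y where "x \<in> S" "y \<notin> S" "R x y"
proof -
  have "b \<in> S \<or> (\<exists>x\<in>S. \<exists>y. y \<notin> S \<and> R x y)"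
    using assms(1) by (induction rule: rtranclp_induct) (use \<open>a \<in> S\<close> in blast)+
  with \<open>b \<notin> S\<close> that show thesis by blast
qed

context simple_plane_graph
begin

text \<open>Only the edge set varies while the vertex set stays that of \<open>G\<close>. The
  relation is thus monotone in \<open>F\<close>, and ends are always read off from
  \<open>verts G\<close>.\<close>

abbreviation linked :: "complex set set \<Rightarrow> complex \<Rightarrow> complex \<Rightarrow> bool" where
  "linked F \<equiv> adjacent (G\<lparr>edges := F\<rparr>)"

lemma linked_iff: "linked F u v \<longleftrightarrow> (\<exists>e\<in>F. e \<inter> verts G = {u, v})"
  by (simp add: adjacent_def)

lemma linked_sym: "linked F u v \<Longrightarrow> linked F v u"
  by (metis linked_iff insert_commute)

lemma linked_rtranclp_sym: "(linked F)\<^sup>*\<^sup>* u v \<Longrightarrow> (linked F)\<^sup>*\<^sup>* v u"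
  by (metis linked_sym sympI sympD symp_rtranclp)

lemma linked_rtranclp_mono: "\<lbrakk>(linked F)\<^sup>*\<^sup>* u v; F \<subseteq> F'\<rbrakk> \<Longrightarrow> (linked F')\<^sup>*\<^sup>* u v"
  by (erule mono_rtranclp[rule_format, rotated]) (auto simp: linked_iff)

lemma edge_ends:
  assumes "e \<in> edges G"
  obtains x y where "e \<inter> verts G = {x, y}" "x \<noteq> y"
  using edge_arc[OF assms] arc_distinct_ends by metis

lemma edge_topology:
  assumes "e \<in> edges G"
  shows "compact e" "connected e" "infinite e" "interior e = {}"
proof -
  obtain g where g: "arc g" "path_image g = e"
    using edge_arc[OF assms] by blast
  show "compact e" "connected e" "interior e = {}"
    using g by (auto simp: compact_arc_image connected_arc_image interior_arc_image)
  obtain x y where "e \<inter> verts G = {x, y}" "x \<noteq> y"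
    using edge_ends[OF assms] .
  then show "infinite e"
    using \<open>connected e\<close> connected_finite_iff_sing[of e] by (metis Int_iff insertI1 insertI2 singletonD empty_iff)
qed

lemma finite_edge_ends: "e \<in> edges G \<Longrightarrow> finite (e \<inter> verts G)"
  by (metis edge_ends finite.simps)

text \<open>An edge outside \<open>F\<close> meets the edges of \<open>F\<close> only in its own two
  ends, so \<open>W\<close> and \<open>F\<close> together cover only finitely many of its infinitely
  many points.\<close>

lemma edge_subset_drawing_mem:
  assumes "e \<in> edges G" "F \<subseteq> edges G" "e \<subseteq> W \<union> \<Union>F" "finite W"
  shows "e \<in> F"
proof (rule ccontr)
  assume "e \<notin> F"
  then have "e \<inter> \<Union>F \<subseteq> verts G"
    using assms edges_meet_in_verts by blast
  with assms(3) have "e \<subseteq> W \<union> (e \<inter> verts G)" by blast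
  then show False
    using assms finite_edge_ends edge_topology(3) by (meson finite_Un finite_subset)
qed

lemma closed_drawing:
  assumes "finite W" "finite F" "F \<subseteq> edges G"
  shows "closed (W \<union> \<Union>F)" "compact (W \<union> \<Union>F)" "interior (W \<union> \<Union>F) = {}"
proof -
  show c: "compact (W \<union> \<Union>F)"
    using assms edge_topology(1)
    by (intro compact_Un compact_Union) (auto simp: finite_imp_compact)
  then show "closed (W \<union> \<Union>F)"
    by (rule compact_imp_closed)
  have "interior (\<Union>F) = {}" "closed (\<Union>F)"
    using assms edge_topology
    by (auto intro!: interior_Union_closed_empty closed_Union compact_imp_closed)
  then show "interior (W \<union> \<Union>F) = {}"
    using interior_closed_Un_empty_interior[of "\<Union>F" W] assms(1)
    by (simp add: Un_commute empty_interior_finite)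
qed

lemma linked_imp_path_component:
  assumes "(linked F)\<^sup>*\<^sup>* u v" "F \<subseteq> edges G" "u \<in> W"
  shows "path_component (W \<union> \<Union>F) u v"
  using assms(1)
proof (induction rule: rtranclp_induct)
  case base
  then show ?case using \<open>u \<in> W\<close> by (simp add: path_component_refl)
next
  case (step y z)
  then obtain e where e: "e \<in> F" "e \<inter> verts G = {y, z}"
    by (auto simp: linked_iff)
  then obtain g where "arc g" "path_image g = e"
    using edge_arc assms(2) by blast
  then have "path_connected e"
    using path_connected_path_image arc_imp_path by blast
  then have "path_component e y z"
    using e by (auto simp: path_connected_component)
  then have "path_component (W \<union> \<Union>F) y z"
    by (rule path_component_of_subset[rotated]) (use e in blast)
  with step.IH show ?case
    by (rule path_component_trans)
qed

text \<open>The tree grows from \<open>w\<close>, each new vertex costing one edge. The bound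
  \<open>card F < card W\<close> stands in for acyclicity.\<close>

lemma spanning_tree:
  assumes "finite W" "w \<in> W" and ends: "\<And>e. e \<in> E \<Longrightarrow> e \<inter> verts G \<subseteq> W"
    and conn: "\<And>v. v \<in> W \<Longrightarrow> (linked E)\<^sup>*\<^sup>* w v"
  obtains F where "F \<subseteq> E" "finite F" "card F < card W" "\<And>v. v \<in> W \<Longrightarrow> (linked F)\<^sup>*\<^sup>* w v"
proof -
  have "n < card W \<Longrightarrow> \<exists>S F. S \<subseteq> W \<and> card S = Suc n \<and> w \<in> S \<and> F \<subseteq> E \<and> finite F \<and> card F \<le> n \<and>
          (\<forall>v\<in>S. (linked F)\<^sup>*\<^sup>* w v)" for n
  proof (induction n)
    case 0
    show ?case
      by (rule exI[of _ "{w}"], rule exI[of _ "{}"]) (use \<open>w \<in> W\<close> in auto)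
  next
    case (Suc n)
    then obtain S F where S: "S \<subseteq> W" "card S = Suc n" "w \<in> S" "F \<subseteq> E" "finite F" "card F \<le> n"
        "\<forall>v\<in>S. (linked F)\<^sup>*\<^sup>* w v"
      using Suc_lessD by blast
    from S Suc.prems have "S \<noteq> W" by auto
    with S obtain v where v: "v \<in> W" "v \<notin> S" by blast
    obtain x y where xy: "x \<in> S" "y \<notin> S" "linked E x y"
      by (rule rtranclp_exit[OF conn[OF v(1)] S(3) v(2)])
    then obtain e where e: "e \<in> E" "e \<inter> verts G = {x, y}"
      by (auto simp: linked_iff)
    have "y \<in> W" using ends[OF e(1)] e(2) by blast
    have reach: "(linked (insert e F))\<^sup>*\<^sup>* w u" if "u \<in> S" for u
      using that S(7) by (blast intro: linked_rtranclp_mono)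
    have "linked (insert e F) x y"
      using e by (auto simp: linked_iff)
    with reach[OF xy(1)] have "(linked (insert e F))\<^sup>*\<^sup>* w y"
      by (rule rtranclp.rtrancl_into_rtrancl)
    moreover have "card (insert y S) = Suc (Suc n)"
      using S xy finite_subset[OF S(1) \<open>finite W\<close>] by simp
    moreover have "card (insert e F) \<le> Suc n"
      using S card_insert_le_m1[of "Suc n" F e] by simp
    ultimately show ?case
      using S e \<open>y \<in> W\<close> reach
      by (intro exI[of _ "insert y S"] exI[of _ "insert e F"]) auto
  qed
  \<comment> \<open>At \<open>n = card W - 1\<close> the reached set has as many elements as
    \<open>W\<close> and hence equals \<open>W\<close>.\<close>
  from this[of "card W - 1"] obtain S F where S: "S \<subseteq> W" "card S = card W" "F \<subseteq> E" "finite F"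
      "card F \<le> card W - 1" "\<forall>v\<in>S. (linked F)\<^sup>*\<^sup>* w v"
    using \<open>finite W\<close> \<open>w \<in> W\<close> by (metis Suc_diff_1 card_gt_0_iff diff_less empty_iff zero_less_one)
  then have "S = W" by (simp add: \<open>finite W\<close> card_subset_eq)
  moreover have "card F < card W"
    using S(5) \<open>finite W\<close> \<open>w \<in> W\<close> card_gt_0_iff[of W] by (cases "card W") auto
  ultimately show thesis using S that by blast
qed

text \<open>
  The inequality in Euler's formula that needs only the Jordan curve theorem: every edge outside a
  spanning tree separates.
\<close>

lemma euler_inequality:
  assumes "finite W" "W \<subseteq> verts G" "w \<in> W" and E: "finite E" "E \<subseteq> edges G"
    and ends: "\<And>e. e \<in> E \<Longrightarrow> e \<inter> verts G \<subseteq> W"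
    and conn: "\<And>v. v \<in> W \<Longrightarrow> (linked E)\<^sup>*\<^sup>* w v"
    and fin: "finite (components (- (W \<union> \<Union>E)))"
  shows "card E + 2 \<le> card W + card (components (- (W \<union> \<Union>E)))"
proof -
  obtain F where F: "F \<subseteq> E" "finite F" "card F < card W" "\<And>v. v \<in> W \<Longrightarrow> (linked F)\<^sup>*\<^sup>* w v"
    using spanning_tree[OF \<open>finite W\<close> \<open>w \<in> W\<close> ends conn] by metis
  have dr: "closed (W \<union> \<Union>B)" "interior (W \<union> \<Union>B) = {}" if "B \<subseteq> E" for B
    using closed_drawing[of W B] that assms finite_subset[OF that] by auto
  \<comment> \<open>The complement of every partial drawing is dense, so the comparison of
    components applies whenever edges are removed. Finiteness descends in this way from the full
    drawing.\<close>
  have dense: "- (W \<union> \<Union>B) \<subseteq> closure (- (W \<union> \<Union>B'))" if "B' \<subseteq> E" for B B'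
    unfolding closure_complement dr(2)[OF that] by simp
  have finB: "finite (components (- (W \<union> \<Union>B)))" if "B \<subseteq> E" for B
    by (rule components_dense_subset(1)[OF open_Compl[OF dr(1)[OF that]] _ dense[OF order_refl] fin])
      (use that in blast)
  \<comment> \<open>The edges outside the tree are added one at a time. The tree alone leaves at
    least one component, which accounts for the \<open>1\<close>.\<close>
  have "card A + 1 \<le> card (components (- (W \<union> \<Union>(F \<union> A))))" if "finite A" "A \<subseteq> E - F" for A
    using that
  proof (induction A rule: finite_subset_induct')
    case empty
    have "- (W \<union> \<Union>(F \<union> {})) \<noteq> {}"
      using dr(2)[of F] F(1) by (metis Un_empty_right compl_bot_eq double_compl interior_UNIV UNIV_not_empty)
    then have "components (- (W \<union> \<Union>(F \<union> {}))) \<noteq> {}"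
      using components_eq_empty by blast
    then show ?case
      using finB[of F] F(1) by (simp add: Suc_le_eq card_gt_0_iff)
  next
    case (insert e A)
    let ?S = "W \<union> \<Union>(F \<union> A)" and ?T = "W \<union> \<Union>(F \<union> insert e A)"
    have T: "?T = ?S \<union> e" by blast
    have sub: "F \<union> A \<subseteq> E" "F \<union> insert e A \<subseteq> E" using insert F by auto
    have e: "e \<in> edges G" "e \<in> E" using insert E by auto
    then obtain g where g: "arc g" "path_image g = e" "e \<inter> verts G = {pathstart g, pathfinish g}"
      using edge_arc by blast
    have st: "pathstart g \<in> W" "pathfinish g \<in> W"
      using ends[OF e(2)] g(3) by auto
    have "e \<inter> \<Union>(F \<union> A) \<subseteq> verts G"
      using insert sub(1) E(2) e(1) edges_meet_in_verts by blast
    then have disj: "path_image g \<inter> ?S = {pathstart g, pathfinish g}"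
      using g st \<open>W \<subseteq> verts G\<close> by blast
    \<comment> \<open>The tree already joins the ends of \<open>e\<close>, so \<open>e\<close>
      closes up to a Jordan curve.\<close>
    have "(linked F)\<^sup>*\<^sup>* (pathfinish g) (pathstart g)"
      using F(4) st linked_rtranclp_sym by (meson rtranclp_trans)
    then have "(linked (F \<union> A))\<^sup>*\<^sup>* (pathfinish g) (pathstart g)"
      by (rule linked_rtranclp_mono) simp
    then have pc: "path_component ?S (pathfinish g) (pathstart g)"
      using linked_imp_path_component sub(1) E(2) st(2) by blast
    obtain a b where "a \<in> - ?T" "b \<in> - ?T"
      "connected_component (- ?S) a b" "\<not> connected_component (- ?T) a b"
      using arc_separates[OF dr(1)[OF sub(1)] g(1) disj pc] unfolding g(2) T by blast
    then have "card (components (- ?S)) < card (components (- ?T))"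
      using components_dense_subset(2)[OF _ _ dense[OF sub(2)] finB[OF sub(2)], of "F \<union> A" a b]
        dr(1)[OF sub(1)] by blast
    then show ?case
      using insert by simp
  qed
  from this[of "E - F"] have "card (E - F) + 1 \<le> card (components (- (W \<union> \<Union>E)))"
    using F(1) \<open>finite E\<close> by (simp add: Un_absorb1)
  then show ?thesis
    using F card_Diff_subset[OF F(2,1)] card_mono[OF \<open>finite E\<close> F(1)] by linarith
qed

section \<open>Edge boundaries\<close>

definition inner_edges :: "complex set \<Rightarrow> complex set set" where
  "inner_edges U = {e \<in> edges G. e \<inter> verts G \<subseteq> U}"

definition edge_boundary :: "complex set \<Rightarrow> complex set set" where
  "edge_boundary U = {e \<in> edges G. e \<inter> verts G \<inter> U \<noteq> {} \<and> \<not> e \<inter> verts G \<subseteq> U}"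

definition incident_edges :: "complex set \<Rightarrow> complex set set" where
  "incident_edges U = (\<Union>v\<in>U. star G v)"

lemma incident_edges_iff: "e \<in> incident_edges U \<longleftrightarrow> e \<in> edges G \<and> e \<inter> U \<noteq> {}"
  by (auto simp: incident_edges_def star_def)

lemma edge_boundaryI:
  "\<lbrakk>e \<in> edges G; e \<inter> verts G = {x, y}; x \<in> U; y \<notin> U\<rbrakk> \<Longrightarrow> e \<in> edge_boundary U"
  by (simp add: edge_boundary_def)

lemma edge_boundaryE:
  assumes "e \<in> edge_boundary U"
  obtains x y where "e \<in> edges G" "e \<inter> verts G = {x, y}" "x \<in> U" "y \<notin> U"
proof -
  have e: "e \<in> edges G" "e \<inter> verts G \<inter> U \<noteq> {}" "\<not> e \<inter> verts G \<subseteq> U"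
    using assms by (auto simp: edge_boundary_def)
  obtain x y where xy: "e \<inter> verts G = {x, y}"
    using edge_ends[OF e(1)] by metis
  then consider "x \<in> U" "y \<notin> U" | "y \<in> U" "x \<notin> U"
    using e(2,3) by auto
  then show thesis
    by cases (use e(1) xy in \<open>auto simp: insert_commute intro: that\<close>)
qed

lemma edge_end_exists: "e \<in> edges G \<Longrightarrow> e \<inter> verts G \<noteq> {}"
  by (metis edge_ends insert_not_empty)

lemma incident_edges_eq:
  assumes "U \<subseteq> verts G"
  shows "incident_edges U = inner_edges U \<union> edge_boundary U" "inner_edges U \<inter> edge_boundary U = {}"
proof -
  have *: "e \<inter> verts G \<inter> U = e \<inter> U" for e
    using assms by blast
  have "e \<inter> U \<noteq> {}" if "e \<in> edges G" "e \<inter> verts G \<subseteq> U" for e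
    using that edge_end_exists[OF that(1)] by blast
  then show "incident_edges U = inner_edges U \<union> edge_boundary U"
    by (auto simp: incident_edges_iff inner_edges_def edge_boundary_def *)
  show "inner_edges U \<inter> edge_boundary U = {}"
    by (auto simp: inner_edges_def edge_boundary_def)
qed

section \<open>Connected induced subgraphs and their drawings\<close>

lemma connected_induced_iff:
  assumes "U \<subseteq> verts G"
  shows "connected_graph (induced G U) \<longleftrightarrow>
    U \<noteq> {} \<and> (\<forall>u\<in>U. \<forall>v\<in>U. (linked (inner_edges U))\<^sup>*\<^sup>* u v)"
proof -
  have "e \<inter> U = e \<inter> verts G" if "e \<in> inner_edges U" for e
    using that assms by (auto simp: inner_edges_def)
  then have "adjacent (induced G U) = linked (inner_edges U)"
    by (intro ext) (auto simp: adjacent_def induced_def inner_edges_def)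
  then show ?thesis
    by (simp add: connected_graph_def induced_def)
qed

text \<open>Two vertices of \<open>W\<close> are joined by going to the connected core
  \<open>U\<close>, through it, and out again.\<close>

lemma connected_induced_extend:
  assumes "connected_graph (induced G U)" "U \<subseteq> W" "W \<subseteq> verts G"
    and reach: "\<And>w. w \<in> W \<Longrightarrow> \<exists>u\<in>U. (linked (inner_edges W))\<^sup>*\<^sup>* w u"
  shows "connected_graph (induced G W)"
proof -
  have U: "U \<noteq> {}" "\<And>u v. \<lbrakk>u \<in> U; v \<in> U\<rbrakk> \<Longrightarrow> (linked (inner_edges U))\<^sup>*\<^sup>* u v"
    using assms(1-3) by (auto simp: connected_induced_iff)
  have "inner_edges U \<subseteq> inner_edges W"
    using assms(2) by (auto simp: inner_edges_def)
  then have U': "(linked (inner_edges W))\<^sup>*\<^sup>* u v" if "u \<in> U" "v \<in> U" for u v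
    using U(2)[OF that] linked_rtranclp_mono by blast
  have "(linked (inner_edges W))\<^sup>*\<^sup>* x y" if "x \<in> W" "y \<in> W" for x y
    using reach[OF that(1)] reach[OF that(2)] U' linked_rtranclp_sym
    by (meson rtranclp_trans)
  then show ?thesis
    using U(1) assms(2,3) by (auto simp: connected_induced_iff)
qed

lemma verts_Int_drawing:
  assumes "W \<subseteq> verts G"
  shows "verts G \<inter> (W \<union> \<Union>(inner_edges W)) = W"
  using assms by (auto simp: inner_edges_def)

lemma support_induced: "support (induced G W) = W \<union> \<Union>(inner_edges W)"
  by (simp add: support_def induced_def inner_edges_def)

text \<open>Distinct edges meet only in vertices, and the drawing of the induced graph contains no
  vertices besides those of \<open>W\<close>.\<close>

lemma edge_disjoint_drawing:
  assumes "W \<subseteq> verts G" "e \<in> edges G" "e \<notin> inner_edges W"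
  shows "e \<inter> support (induced G W) = e \<inter> W"
proof -
  have "e \<inter> \<Union>(inner_edges W) \<subseteq> verts G"
    using assms edges_meet_in_verts by (auto simp: inner_edges_def)
  then show ?thesis
    using verts_Int_drawing[OF assms(1)] unfolding support_induced by blast
qed

lemma edge_subset_component:
  assumes "W \<subseteq> verts G" "C \<in> components (- support (induced G W))" "e \<in> edges G" "e \<inter> C \<noteq> {}"
    and "e \<inter> W = {}"
  shows "e \<subseteq> C"
proof -
  have "e \<notin> inner_edges W"
    using assms(3,5) edge_end_exists by (auto simp: inner_edges_def)
  then have "e \<inter> support (induced G W) = {}"
    using edge_disjoint_drawing assms by blast
  then show ?thesis
    using assms edge_topology(2) components_maximal[of C "- support (induced G W)" e] by blast
qed

text \<open>For edges that cross a face: their ends may lie on the drawing, but the connected rest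
  stays in one component and determines the edge by closure.\<close>

lemma connected_edge_interior:
  assumes "e \<in> edges G"
  shows "connected (e - verts G)" "e \<subseteq> closure (e - verts G)"
proof -
  obtain g where g: "arc g" "path_image g = e" "e \<inter> verts G = {pathstart g, pathfinish g}"
    using edge_arc[OF assms] by blast
  have "e - verts G = path_image g - {pathstart g, pathfinish g}"
    using g by blast
  then show "connected (e - verts G)"
    using connected_simple_path_endless[OF arc_imp_simple_path[OF g(1)]] by simp
  show "e \<subseteq> closure (e - verts G)"
  proof
    fix x assume "x \<in> e"
    have "e \<noteq> {x}" for x
      using edge_topology(3)[OF assms] by auto
    then have "x islimpt e"
      using connected_imp_perfect[OF edge_topology(2)[OF assms] \<open>x \<in> e\<close>] by blast
    then have "x islimpt ((e \<inter> verts G) \<union> (e - verts G))"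
      by (simp add: Int_Diff_Un)
    then have "x islimpt (e - verts G)"
      using islimpt_Un_finite[OF finite_edge_ends[OF assms]] by blast
    then show "x \<in> closure (e - verts G)"
      by (simp add: closure_def)
  qed
qed

text \<open>The far ends of the incident edges are included, as \<open>subgraph\<close>
  demands.\<close>

definition star_graph :: "complex set \<Rightarrow> plane_graph" where
  "star_graph W = \<lparr>verts = W \<union> (\<Union>(incident_edges W) \<inter> verts G), edges = incident_edges W\<rparr>"

lemma ends_star_graph:
  assumes "W \<subseteq> verts G" "e \<in> incident_edges W"
  shows "e \<inter> verts (star_graph W) = e \<inter> verts G"
  using assms by (auto simp: star_graph_def)

end

section \<open>Connected sets of minimal boundary\<close>

context tessellating_graph
begin

section \<open>Consequences of local finiteness\<close>

lemma finite_incident_edges: "\<lbrakk>finite U; U \<subseteq> verts G\<rbrakk> \<Longrightarrow> finite (incident_edges U)"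
  using locally_finite by (auto simp: incident_edges_def)

lemma finite_inner_edge_boundary:
  assumes "finite U" "U \<subseteq> verts G"
  shows "finite (inner_edges U)" "finite (edge_boundary U)"
  using finite_incident_edges[OF assms] incident_edges_eq(1)[OF assms(2)] by auto

lemma support_induced_compact:
  assumes "finite W" "W \<subseteq> verts G"
  shows "compact (support (induced G W))" "support (induced G W) \<subseteq> support G"
  unfolding support_induced
  using closed_drawing(2)[of W "inner_edges W"] finite_inner_edge_boundary(1) assms
  by (auto simp: inner_edges_def support_def)

lemma linked_total: "\<lbrakk>u \<in> verts G; v \<in> verts G\<rbrakk> \<Longrightarrow> (linked (edges G))\<^sup>*\<^sup>* u v"
  using connected by (simp add: connected_graph_def)

lemma star_nonempty: "v \<in> verts G \<Longrightarrow> star G v \<noteq> {}"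
  using deg_ge_3[of v] by (auto simp: deg_def)

text \<open>A path from \<open>U\<close> to one of the infinitely many other vertices must leave
  \<open>U\<close>. This gives the bound \<open>1\<close> that handles star graphs of small
  volume.\<close>

lemma edge_boundary_nonempty:
  assumes "finite U" "U \<subseteq> verts G" "U \<noteq> {}"
  shows "edge_boundary U \<noteq> {}"
proof -
  obtain v where v: "v \<in> verts G" "v \<notin> U"
    using infinite_verts assms(1,2) by (metis finite_subset subsetI)
  obtain u where u: "u \<in> U" using assms(3) by blast
  obtain x y where "x \<in> U" "y \<notin> U" "linked (edges G) x y"
    by (rule rtranclp_exit[OF linked_total[of u v] u v(2)]) (use u v assms in auto)
  then obtain e where "e \<in> edges G" "e \<inter> verts G = {x, y}" "x \<in> U" "y \<notin> U"
    unfolding linked_iff by blast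
  then show ?thesis using edge_boundaryI by blast
qed

lemma tileE:
  assumes "T \<in> tiles G"
  obtains D where "D \<in> components (- support G)" "T = closure D" "open D" "frontier T \<subseteq> support G"
proof -
  obtain D where D: "D \<in> components (- support G)" "T = closure D"
    using assms by (auto simp: tiles_def)
  have "frontier T \<subseteq> frontier D"
    using interior_mono[OF closure_subset[of D]] D(2) by (auto simp: frontier_def)
  also have "\<dots> \<subseteq> support G"
    using frontier_of_components_closed_complement[OF closed_support D(1)] .
  finally show thesis
    using that[OF D] open_components[OF _ D(1)] closed_support by blast
qed

lemma bounded_tile_frontier:
  assumes "T \<in> tiles G" "bounded T"
  shows "finite (frontier T \<inter> verts G)" "\<exists>e\<in>edges G. e \<subseteq> frontier T"
    "finite {e \<in> edges G. e \<subseteq> frontier T}"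
proof -
  obtain n v e where X: "3 \<le> n" "frontier T = (\<Union>i<n. e i)"
      "\<forall>i<n. e i \<in> edges G \<and> e i \<inter> verts G = {v i, v (Suc i mod n)}"
    using bounded_tile[OF assms] unfolding consists_of_finite_cycle_def by blast
  have "frontier T \<inter> verts G = (\<Union>i<n. e i \<inter> verts G)"
    using X(2) by auto
  then show "finite (frontier T \<inter> verts G)"
    using X(3) by auto
  have "0 < n" using X(1) by linarith
  then show "\<exists>e\<in>edges G. e \<subseteq> frontier T"
    using X(2,3) by (intro bexI[of _ "e 0"]) auto
  \<comment> \<open>The edges lying in the frontier are exactly those of the cycle, since an edge
    covered by finitely many edges is one of them.\<close>
  have "f \<in> e ` {..<n}" if "f \<in> edges G" "f \<subseteq> frontier T" for f
    using that X(2,3) by (intro edge_subset_drawing_mem[where W = "{}" and F = "e ` {..<n}"]) auto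
  then show "finite {e \<in> edges G. e \<subseteq> frontier T}"
    by (auto intro: finite_subset[of _ "e ` {..<n}"])
qed

lemma edge_in_tile:
  assumes "e \<in> edges G"
  obtains T where "T \<in> tiles G" "e \<subseteq> frontier T"
  using edge_in_two_tiles[OF assms] by (metis (mono_tags, lifting) card.empty empty_Collect_eq zero_neq_numeral)

text \<open>
  Every tile at such a vertex lies in the closure of the same bounded component, and by local
  finiteness there are only finitely many of them, each with finitely many vertices.
\<close>

lemma finite_verts_bounded_components:
  assumes "closed S" "S \<subseteq> support G" "bounded S"
  shows "finite (verts G \<inter> \<Union>{C \<in> components (- S). bounded C})"
proof -
  let ?B = "\<Union>{C \<in> components (- S). bounded C}"
  have "?B \<subseteq> S \<union> inside S"
    unfolding inside_def components_def
    by (auto simp: connected_component_eq)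
  then have bB: "bounded ?B"
    using assms(1,3) by (meson bounded_Un bounded_inside bounded_subset)
  let ?\<T> = "{T \<in> tiles G. bounded T \<and> T \<inter> closure ?B \<noteq> {}}"
  have fin: "finite ?\<T>"
    by (rule finite_subset[OF _ tiles_locally_finite[of "closure ?B"]]) (use bB in auto)
  have "verts G \<inter> ?B \<subseteq> (\<Union>T\<in>?\<T>. frontier T \<inter> verts G)"
  proof
    fix v assume v: "v \<in> verts G \<inter> ?B"
    then obtain C where C: "C \<in> components (- S)" "bounded C" "v \<in> C" by blast
    obtain e where e: "e \<in> edges G" "v \<in> e"
      using star_nonempty[of v] v by (auto simp: star_def)
    obtain T where T: "T \<in> tiles G" "e \<subseteq> frontier T"
      using edge_in_tile[OF e(1)] .
    obtain D where D: "D \<in> components (- support G)" "T = closure D"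
      using tileE[OF T(1)] by metis
    have "frontier T \<subseteq> T"
      using D(2) by (simp add: frontier_subset_closed)
    then have vT: "v \<in> T" using e T by blast
    \<comment> \<open>The vertex lies in the closure of \<open>D\<close>, so its open neighbourhood
      \<open>C\<close> meets \<open>D\<close>. As \<open>D\<close> is connected and avoids
      \<open>S\<close>, it lies in \<open>C\<close>.\<close>
    have "open C" using C(1) assms(1) by (meson open_Compl open_components)
    then have "C \<inter> D \<noteq> {}"
      using open_Int_closure_eq_empty[of C D] vT C(3) D(2) by blast
    moreover have "D \<subseteq> - S"
      using in_components_subset[OF D(1)] assms(2) by blast
    ultimately have "D \<subseteq> C"
      using components_maximal[OF C(1) in_components_connected[OF D(1)]] by blast
    then have "T \<subseteq> closure C" "bounded T"
      using D(2) C(2) by (auto simp: closure_mono intro: bounded_subset)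
    moreover have "v \<in> closure ?B"
      using v closure_subset[of ?B] by (meson IntD2 subsetD)
    ultimately have "T \<in> ?\<T>" using T(1) vT by blast
    then show "v \<in> (\<Union>T\<in>?\<T>. frontier T \<inter> verts G)"
      using v e T by blast
  qed
  moreover have "finite (\<Union>T\<in>?\<T>. frontier T \<inter> verts G)"
    by (rule finite_UN_I[OF fin]) (simp add: bounded_tile_frontier(1))
  ultimately show ?thesis
    by (rule finite_subset)
qed

section \<open>Tight vertex sets and their faces\<close>

definition tight :: "complex set \<Rightarrow> bool" where
  "tight W \<longleftrightarrow> finite W \<and> W \<subseteq> verts G \<and> connected_graph (induced G W) \<and>
     (\<forall>W'. finite W' \<and> W \<subseteq> W' \<and> W' \<subseteq> verts G \<and> connected_graph (induced G W') \<longrightarrow>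
        card (edge_boundary W) \<le> card (edge_boundary W'))"

text \<open>Boundary sizes are natural numbers, so a minimizer among the supersets of
  \<open>U\<close> exists. Supersets of the minimizer again contain \<open>U\<close>, so tightness
  need not mention \<open>U\<close>.\<close>

lemma tight_superset:
  assumes "finite U" "U \<subseteq> verts G" "connected_graph (induced G U)"
  obtains W where "tight W" "U \<subseteq> W" "card (edge_boundary W) \<le> card (edge_boundary U)"
proof -
  define P where "P W \<longleftrightarrow> finite W \<and> U \<subseteq> W \<and> W \<subseteq> verts G \<and> connected_graph (induced G W)" for W
  have "P U" using assms by (simp add: P_def)
  then obtain W where W: "P W" "\<And>W'. P W' \<Longrightarrow> card (edge_boundary W) \<le> card (edge_boundary W')"
    using ex_has_least_nat[of P U "\<lambda>W. card (edge_boundary W)"] by blast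
  then have "tight W"
    unfolding tight_def P_def by (meson order_trans)
  with W \<open>P U\<close> that show thesis by (auto simp: P_def)
qed

text \<open>The common contradiction for enlargements: one that stays connected to \<open>W\<close>
  cannot lose boundary edges without gaining others.\<close>

lemma tight_edge_boundary_not_psubset:
  assumes "tight W" "finite W'" "W \<subseteq> W'" "W' \<subseteq> verts G"
    and "\<And>w. w \<in> W' \<Longrightarrow> \<exists>u\<in>W. (linked (inner_edges W'))\<^sup>*\<^sup>* w u"
  shows "\<not> edge_boundary W' \<subset> edge_boundary W"
proof -
  have "connected_graph (induced G W')"
    by (rule connected_induced_extend[of W]) (use assms in \<open>auto simp: tight_def\<close>)
  then have "card (edge_boundary W) \<le> card (edge_boundary W')"
    using assms unfolding tight_def by blast
  moreover have "finite (edge_boundary W)"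
    using assms finite_inner_edge_boundary by (simp add: tight_def)
  ultimately show ?thesis
    using psubset_card_mono by (metis leD)
qed

text \<open>Every edge at \<open>v\<close> leads into \<open>W\<close>. Adding \<open>v\<close>
  turns these edges into inner ones and creates no boundary edge; the star of \<open>v\<close> is
  nonempty, so the loss is strict.\<close>

lemma tight_absorbs_surrounded:
  assumes W: "tight W" and v: "v \<in> verts G" "star G v \<subseteq> incident_edges W"
  shows "v \<in> W"
proof (rule ccontr)
  assume "v \<notin> W"
  have sub: "W \<subseteq> verts G" "finite W" using W by (auto simp: tight_def)
  have ends: "\<exists>w\<in>W. e \<inter> verts G = {v, w}" if e: "e \<in> edges G" "v \<in> e" for e
  proof -
    have "e \<inter> W \<noteq> {}"
      using e v(2) by (auto simp: incident_edges_iff star_def)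
    then obtain w where "w \<in> W" "w \<in> e" by blast
    moreover obtain x y where xy: "e \<inter> verts G = {x, y}"
      using edge_ends[OF e(1)] by metis
    moreover have "v \<in> e \<inter> verts G" "w \<in> e \<inter> verts G"
      using e v(1) sub(1) \<open>w \<in> W\<close> \<open>w \<in> e\<close> by auto
    ultimately have "e \<inter> verts G = {v, w}"
      using \<open>v \<notin> W\<close> by auto
    with \<open>w \<in> W\<close> show ?thesis by blast
  qed
  obtain e where e: "e \<in> edges G" "v \<in> e"
    using star_nonempty[OF v(1)] by (auto simp: star_def)
  obtain w where w: "w \<in> W" "e \<inter> verts G = {v, w}"
    using ends[OF e] by blast
  have "edge_boundary (insert v W) \<subseteq> edge_boundary W"
  proof
    fix f assume f: "f \<in> edge_boundary (insert v W)"
    have "v \<notin> f"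
      using ends[of f] f by (auto simp: edge_boundary_def)
    with f show "f \<in> edge_boundary W" by (auto simp: edge_boundary_def)
  qed
  moreover have "e \<in> edge_boundary W"
    using edge_boundaryI[of e w v] e w \<open>v \<notin> W\<close> by (simp add: insert_commute)
  moreover have "e \<notin> edge_boundary (insert v W)"
    using w by (simp add: edge_boundary_def)
  ultimately have "edge_boundary (insert v W) \<subset> edge_boundary W" by blast
  moreover have "\<not> edge_boundary (insert v W) \<subset> edge_boundary W"
  proof (rule tight_edge_boundary_not_psubset[OF W])
    fix u assume u: "u \<in> insert v W"
    have "linked (inner_edges (insert v W)) v w"
      using e w by (auto simp: linked_iff inner_edges_def)
    then show "\<exists>w\<in>W. (linked (inner_edges (insert v W)))\<^sup>*\<^sup>* u w"
      using u w by blast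
  qed (use sub v in auto)
  ultimately show False by blast
qed

text \<open>All bounded faces are filled at once. Only finitely many vertices are added, and no edge
  leads from them out of the enlarged set.\<close>

lemma tight_no_verts_inside:
  assumes W: "tight W" and C: "C \<in> components (- support (induced G W))" "bounded C"
  shows "verts G \<inter> C = {}"
proof (rule ccontr)
  assume ne: "verts G \<inter> C \<noteq> {}"
  have sub: "W \<subseteq> verts G" "finite W" "W \<noteq> {}"
    using W by (auto simp: tight_def connected_graph_def induced_def)
  let ?S = "support (induced G W)"
  let ?B = "\<Union>{C \<in> components (- ?S). bounded C}"
  define W' where "W' = W \<union> (verts G \<inter> ?B)"
  have cS: "compact ?S" "?S \<subseteq> support G"
    using support_induced_compact[OF sub(2,1)] .
  have WS: "W \<subseteq> ?S" by (simp add: support_induced)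
  have disj: "W \<inter> ?B = {}"
    using WS in_components_subset[of _ "- ?S"] by blast
  have W': "finite W'" "W \<subseteq> W'" "W' \<subseteq> verts G"
    using sub finite_verts_bounded_components[of ?S] cS
    by (auto simp: W'_def compact_imp_closed compact_imp_bounded)
  \<comment> \<open>An edge at a vertex inside a bounded face either misses \<open>W\<close> and
    stays inside that face, or its other end is in \<open>W\<close>.\<close>
  have near: "y \<in> W'" if e: "e \<in> edges G" "e \<inter> verts G = {x, y}" and x: "x \<in> ?B" for e x y
  proof -
    have xy: "x \<in> e" "y \<in> e" "y \<in> verts G" using e(2) by auto
    obtain D where D: "D \<in> components (- ?S)" "bounded D" "x \<in> D" using x by blast
    show ?thesis
    proof (cases "e \<inter> W = {}")
      case True
      then have "e \<subseteq> D"
        using edge_subset_component[OF sub(1) D(1) e(1)] D(3) xy(1) by blast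
      with D xy show ?thesis by (auto simp: W'_def)
    next
      case False
      then have "{x, y} \<inter> W \<noteq> {}"
        unfolding e(2)[symmetric] using sub(1) by blast
      moreover have "x \<notin> W" using x disj by blast
      ultimately show ?thesis by (auto simp: W'_def)
    qed
  qed
  have "edge_boundary W' \<subseteq> edge_boundary W"
  proof
    fix e assume "e \<in> edge_boundary W'"
    then obtain x y where e: "e \<in> edges G" "e \<inter> verts G = {x, y}" "x \<in> W'" "y \<notin> W'"
      by (rule edge_boundaryE)
    then have "x \<notin> ?B" using near by blast
    then have "x \<in> W" using e(3) by (auto simp: W'_def)
    then show "e \<in> edge_boundary W"
      using edge_boundaryI[OF e(1,2)] e(4) W'(2) by blast
  qed
  moreover obtain e where "e \<in> edge_boundary W" "e \<notin> edge_boundary W'"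
  proof -
    obtain x where x: "x \<in> verts G" "x \<in> ?B" using ne C by blast
    obtain u where u: "u \<in> W" using sub(3) by blast
    \<comment> \<open>Strictness: a path from \<open>x\<close> to \<open>W\<close> leaves the
      bounded faces along an edge into \<open>W\<close>, which is a boundary edge of
      \<open>W\<close> but an inner edge of \<open>W'\<close>.\<close>
    obtain y z where yz: "y \<in> verts G \<inter> ?B" "z \<notin> verts G \<inter> ?B" "linked (edges G) y z"
      by (rule rtranclp_exit[OF linked_total[of x u], of "verts G \<inter> ?B"]) (use x u disj sub in auto)
    then obtain e where e: "e \<in> edges G" "e \<inter> verts G = {y, z}"
      unfolding linked_iff by blast
    have "z \<in> W'" "z \<in> verts G"
      using near[OF e] yz(1) e(2) by auto
    then have in': "e \<inter> verts G \<subseteq> W'"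
      using e(2) yz(1) by (auto simp: W'_def)
    have "z \<in> W" using \<open>z \<in> W'\<close> \<open>z \<in> verts G\<close> yz(2) by (auto simp: W'_def)
    then have "e \<in> edge_boundary W"
      using edge_boundaryI[of e z y] e yz(1) disj by (auto simp: insert_commute simp del: Union_iff)
    moreover have "e \<notin> edge_boundary W'"
      using in' by (simp add: edge_boundary_def)
    ultimately show thesis by (rule that)
  qed
  ultimately have "edge_boundary W' \<subset> edge_boundary W" by blast
  moreover have "\<not> edge_boundary W' \<subset> edge_boundary W"
  proof (rule tight_edge_boundary_not_psubset[OF W W'])
    fix w assume w: "w \<in> W'"
    obtain u where u: "u \<in> W" using sub(3) by blast
    \<comment> \<open>A path in \<open>G\<close> towards \<open>u\<close> is followed only until it
      first hits \<open>W\<close>; up to there it cannot leave \<open>W'\<close>.\<close>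
    have "(linked (edges G))\<^sup>*\<^sup>* w u"
      using linked_total w u W' by blast
    then show "\<exists>u\<in>W. (linked (inner_edges W'))\<^sup>*\<^sup>* w u"
      using w
    proof (induction rule: converse_rtranclp_induct)
      case base
      then show ?case using u by blast
    next
      case (step y z)
      show ?case
      proof (cases "y \<in> W")
        case False
        obtain e where e: "e \<in> edges G" "e \<inter> verts G = {y, z}"
          using step.hyps unfolding linked_iff by blast
        have "y \<in> ?B" using False step.prems by (auto simp: W'_def)
        then have "z \<in> W'"
          using near[OF e] by blast
        moreover from this have "linked (inner_edges W') y z"
          unfolding linked_iff using e step.prems by (intro bexI[of _ e]) (auto simp: inner_edges_def)
        ultimately show ?thesis
          using step.IH by (meson converse_rtranclp_into_rtranclp)
      qed blast
    qed
  qed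
  ultimately show False by blast
qed

text \<open>An edge meeting the vertex-free face \<open>C\<close> would have its interior in
  \<open>C\<close> and its ends on the drawing, hence in \<open>W\<close>. It would then be an inner
  edge and part of the drawing itself. So \<open>C\<close> avoids all of \<open>G\<close>.\<close>

lemma tight_component:
  assumes W: "tight W" and C: "C \<in> components (- support (induced G W))" "bounded C"
  shows "C \<in> components (- support G)"
proof -
  let ?S = "support (induced G W)"
  have sub: "W \<subseteq> verts G" "finite W"
    using W by (auto simp: tight_def)
  have cS: "closed ?S" "?S \<subseteq> support G"
    using support_induced_compact[OF sub(2,1)] by (auto simp: compact_imp_closed)
  have CS: "C \<inter> ?S = {}"
    using in_components_subset[OF C(1)] by blast
  have no_verts: "verts G \<inter> C = {}"
    using tight_no_verts_inside[OF W C] .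
  have "e \<inter> C = {}" if e: "e \<in> edges G" for e
  proof (rule ccontr)
    assume "e \<inter> C \<noteq> {}"
    then have ne: "(e - verts G) \<inter> C \<noteq> {}"
      using no_verts by blast
    have out: "e \<notin> inner_edges W"
      using \<open>e \<inter> C \<noteq> {}\<close> CS by (auto simp: support_induced)
    have "(e - verts G) \<subseteq> - ?S"
      using edge_disjoint_drawing[OF sub(1) e out] sub(1) by blast
    then have "e - verts G \<subseteq> C"
      using components_maximal[OF C(1) connected_edge_interior(1)[OF e]] ne by blast
    then have "e \<subseteq> closure C"
      using connected_edge_interior(2)[OF e] closure_mono by blast
    moreover have "closure C \<subseteq> C \<union> ?S"
      using frontier_of_components_closed_complement[OF cS(1) C(1)] closure_Un_frontier[of C] by blast
    ultimately have "e \<inter> verts G \<subseteq> verts G \<inter> ?S"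
      using no_verts by blast
    then have "e \<inter> verts G \<subseteq> W"
      using verts_Int_drawing[OF sub(1)] by (simp add: support_induced)
    then show False
      using out e by (simp add: inner_edges_def)
  qed
  then have "C \<subseteq> - support G"
    using no_verts by (auto simp: support_def)
  then show ?thesis
    using components_intermediate_subset[OF C(1)] cS(2) by blast
qed

text \<open>This is completeness. Bounded faces are tiles by \<open>tight_component\<close>.
  Conversely, a tile whose frontier lies in the drawing fills the component around it, which cannot
  cross that frontier.\<close>

lemma tight_tiles:
  assumes W: "tight W"
  shows "tiles_bounded_by G (induced G W) =
    closure ` {C \<in> components (- support (induced G W)). bounded C}" (is "?P = ?F")
proof (intro equalityI subsetI)
  let ?S = "support (induced G W)"
  have sub: "W \<subseteq> verts G" "finite W"
    using W by (auto simp: tight_def)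
  have cS: "closed ?S" "?S \<subseteq> support G"
    using support_induced_compact[OF sub(2,1)] by (auto simp: compact_imp_closed)
  show "T \<in> ?P" if "T \<in> ?F" for T
  proof -
    obtain C where C: "C \<in> components (- ?S)" "bounded C" "T = closure C"
      using \<open>T \<in> ?F\<close> by blast
    have "frontier T \<subseteq> frontier C"
      using interior_mono[OF closure_subset[of C]] C(3) by (auto simp: frontier_def)
    also have "\<dots> \<subseteq> ?S"
      using frontier_of_components_closed_complement[OF cS(1) C(1)] .
    finally show ?thesis
      using tight_component[OF W C(1,2)] C(3) by (simp add: tiles_bounded_by_def tiles_def)
  qed
  show "T \<in> ?F" if "T \<in> ?P" for T
  proof -
    have T: "T \<in> tiles G" "frontier T \<subseteq> ?S"
      using that by (auto simp: tiles_bounded_by_def)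
    \<comment> \<open>The infinite chain around an unbounded tile would put infinitely many vertices
      into the finite set \<open>W\<close>.\<close>
    have "bounded T"
    proof (rule ccontr)
      assume "\<not> bounded T"
      then obtain v :: "int \<Rightarrow> complex" and e where v: "inj v" "frontier T = (\<Union>i. e i)"
          "\<forall>i. e i \<in> edges G \<and> e i \<inter> verts G = {v i, v (i + 1)}"
        using unbounded_tile[OF T(1)] unfolding consists_of_infinite_chain_def by blast
      have "v i \<in> W" for i
      proof -
        have "v i \<in> e i \<inter> verts G" using v(3) by blast
        then have "v i \<in> verts G \<inter> ?S" using v(2) T(2) by blast
        then show ?thesis
          using verts_Int_drawing[OF sub(1)] by (simp add: support_induced)
      qed
      then have "finite (range v)"
        using sub(2) by (meson finite_subset image_subsetI)
      then show False
        using v(1) finite_imageD infinite_UNIV_int by blast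
    qed
    obtain D where D: "D \<in> components (- support G)" "T = closure D"
      using tileE[OF T(1)] by metis
    have "D \<subseteq> - ?S" "D \<noteq> {}" "connected D"
      using D(1) cS(2) in_components_subset in_components_nonempty in_components_connected by blast+
    then obtain C where C: "C \<in> components (- ?S)" "D \<subseteq> C"
      using exists_component_superset[of D "- ?S"] by auto
    have "C \<inter> frontier T = {}"
      using in_components_subset[OF C(1)] T(2) by blast
    moreover have "C \<inter> T \<noteq> {}"
      using \<open>D \<noteq> {}\<close> C(2) D(2) closure_subset[of D] by auto
    ultimately have "C \<subseteq> T"
      using connected_Int_frontier[OF in_components_connected[OF C(1)], of T] by blast
    then have "closure C = T"
      using D(2) C(2) closure_mono closure_minimal by (metis closed_closure subset_antisym)
    moreover have "bounded C"
      using \<open>C \<subseteq> T\<close> \<open>bounded T\<close> bounded_subset by blast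
    ultimately show ?thesis
      using C(1) by blast
  qed
qed

lemma tight_tiles_bounded: "\<lbrakk>tight W; T \<in> tiles_bounded_by G (induced G W)\<rbrakk> \<Longrightarrow> bounded T"
  by (auto simp: tight_tiles)

lemma finite_tiles_bounded_by:
  assumes W: "tight W"
  shows "finite (tiles_bounded_by G (induced G W))"
proof (rule finite_subset[OF _ tiles_locally_finite])
  show "compact (support (induced G W))"
    using support_induced_compact(1) W by (simp add: tight_def)
  show "tiles_bounded_by G (induced G W) \<subseteq> {T \<in> tiles G. T \<inter> support (induced G W) \<noteq> {}}"
  proof
    fix T assume P: "T \<in> tiles_bounded_by G (induced G W)"
    then have T: "T \<in> tiles G" "frontier T \<subseteq> support (induced G W)"
      by (auto simp: tiles_bounded_by_def)
    obtain e where "e \<in> edges G" "e \<subseteq> frontier T"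
      using bounded_tile_frontier(2)[OF T(1) tight_tiles_bounded[OF W P]] by blast
    then have "frontier T \<noteq> {}" using edge_end_exists by blast
    moreover have "frontier T \<subseteq> T"
      using tileE[OF T(1)] by (metis closed_closure frontier_subset_closed)
    ultimately show "T \<in> {T \<in> tiles G. T \<inter> support (induced G W) \<noteq> {}}"
      using T by blast
  qed
qed

text \<open>Bounded components correspond to tiles, and at most one component is unbounded. Dropping
  the latter turns the \<open>2\<close> of \<open>euler_inequality\<close> into
  \<open>1\<close>.\<close>

lemma tight_euler:
  assumes W: "tight W"
  shows "card (inner_edges W) + 1 \<le> card W + card (tiles_bounded_by G (induced G W))"
proof -
  let ?S = "support (induced G W)"
  let ?B = "{C \<in> components (- ?S). bounded C}" and ?U = "{C \<in> components (- ?S). \<not> bounded C}"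
  have sub: "W \<subseteq> verts G" "finite W" "W \<noteq> {}"
    using W by (auto simp: tight_def connected_graph_def induced_def)
  have cS: "compact ?S"
    using support_induced_compact(1)[OF sub(2,1)] .
  have inj: "inj_on closure ?B"
    using inj_on_closure_components[of "- ?S"] cS by (auto intro: inj_on_subset compact_imp_closed)
  have card_B: "card ?B = card (tiles_bounded_by G (induced G W))"
    using card_image[OF inj] tight_tiles[OF W] by simp
  have fin_B: "finite ?B"
    using finite_imageD[OF _ inj] finite_tiles_bounded_by[OF W] tight_tiles[OF W] by simp
  have U: "C = D" if "C \<in> ?U" "D \<in> ?U" for C D
    using that cobounded_unique_unbounded_components[of "- ?S" D C] compact_imp_bounded[OF cS] by simp
  have U1: "finite ?U \<and> card ?U \<le> 1"
  proof (cases "?U = {}")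
    case True
    show ?thesis unfolding True by simp
  next
    case False
    then obtain C where "C \<in> ?U" by blast
    with U have C: "?U = {C}" by blast
    show ?thesis unfolding C by simp
  qed
  have BU: "?B \<union> ?U = components (- ?S)" by blast
  have fin: "finite (components (- ?S))"
    using finite_UnI[OF fin_B, of ?U] U1 unfolding BU by blast
  have card: "card (components (- ?S)) \<le> card ?B + 1"
    using card_Un_le[of ?B ?U] U1 unfolding BU by linarith
  obtain w where w: "w \<in> W" using sub(3) by blast
  have "card (inner_edges W) + 2 \<le> card W + card (components (- ?S))"
    unfolding support_induced
  proof (rule euler_inequality[OF sub(2,1) w])
    show "(linked (inner_edges W))\<^sup>*\<^sup>* w v" if "v \<in> W" for v
      using W w that connected_induced_iff[OF sub(1)] by (auto simp: tight_def)
  qed (use fin finite_inner_edge_boundary sub in \<open>auto simp: inner_edges_def support_induced\<close>)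
  then show ?thesis using card card_B by linarith
qed

section \<open>Star graphs of tight sets, and the reduction to connected sets\<close>

lemma finite_subgraph_star_graph:
  assumes "finite W" "W \<subseteq> verts G"
  shows "finite_subgraph (star_graph W) G"
proof -
  have fin: "finite (incident_edges W)"
    using finite_incident_edges assms by blast
  have "finite (\<Union>e\<in>incident_edges W. e \<inter> verts G)"
    by (rule finite_UN_I[OF fin]) (simp add: finite_edge_ends incident_edges_iff)
  also have "(\<Union>e\<in>incident_edges W. e \<inter> verts G) = \<Union>(incident_edges W) \<inter> verts G"
    by blast
  finally show ?thesis
    using assms fin by (auto simp: finite_subgraph_def subgraph_def star_graph_def incident_edges_iff)
qed

text \<open>Vertices of \<open>W\<close> keep their full star. Any other vertex misses an edge by
  \<open>tight_absorbs_surrounded\<close>, so it is a boundary vertex.\<close>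

lemma tight_interior_graph:
  assumes W: "tight W"
  shows "interior_graph G (star_graph W) = induced G W"
proof -
  have sub: "W \<subseteq> verts G" "finite W"
    using W by (auto simp: tight_def)
  have star_sub: "star (star_graph W) v \<subseteq> star G v" for v
    by (auto simp: star_def star_graph_def incident_edges_iff)
  have "star (star_graph W) v = star G v" if "v \<in> W" for v
    using that by (auto simp: star_def star_graph_def incident_edges_iff)
  then have full: "deg (star_graph W) v = deg G v" if "v \<in> W" for v
    using that by (simp add: deg_def)
  have not_full: "deg (star_graph W) v < deg G v" if v: "v \<in> verts G" "v \<notin> W" for v
  proof -
    have "\<not> star G v \<subseteq> incident_edges W"
      using tight_absorbs_surrounded[OF W] v by blast
    then have "star (star_graph W) v \<subset> star G v"
      using star_sub by (auto simp: star_def star_graph_def)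
    then show ?thesis
      unfolding deg_def using locally_finite[OF v(1)] by (rule psubset_card_mono[rotated])
  qed
  have verts: "verts (star_graph W) - boundary_verts G (star_graph W) = W"
    using full not_full sub(1) by (auto simp: boundary_verts_def star_graph_def)
  have "e \<in> incident_edges W" if "e \<in> edges G" "e \<inter> verts G \<subseteq> W" for e
    using that incident_edges_eq(1)[OF sub(1)] by (auto simp: inner_edges_def)
  then have "{e \<in> incident_edges W. e \<inter> verts (star_graph W) \<subseteq> W} = {e \<in> edges G. e \<inter> verts G \<subseteq> W}"
    using ends_star_graph[OF sub(1)] by (auto simp: incident_edges_iff)
  then show ?thesis
    unfolding interior_graph_def verts by (simp add: induced_def star_graph_def)
qed

lemma tight_star_like_complete:
  assumes W: "tight W"
  shows "star_graph W \<in> star_like_complete_subgraphs G"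
proof -
  have "complete_subgraph G (star_graph W)"
    unfolding complete_subgraph_def tight_interior_graph[OF W] bounded_faces_def
    using tight_tiles[OF W] by simp
  moreover have "star_like G (star_graph W)"
    unfolding star_like_def using W
    by (intro exI[of _ W]) (auto simp: tight_def star_graph_def incident_edges_def)
  ultimately show ?thesis
    using finite_subgraph_star_graph W by (simp add: star_like_complete_subgraphs_def tight_def)
qed

text \<open>Induction splits off the connected component \<open>U1\<close> of a vertex. No edge
  touches both \<open>U1\<close> and the rest, so incident edges and edge boundaries are disjoint
  and both sides add up.\<close>

lemma isoperimetric_from_connected:
  fixes \<mu> :: "complex set \<Rightarrow> real"
  assumes nonneg: "\<And>e. e \<in> edges G \<Longrightarrow> 0 \<le> \<mu> e"
    and conn: "\<And>U. \<lbrakk>finite U; U \<subseteq> verts G; connected_graph (induced G U)\<rbrakk>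
      \<Longrightarrow> sum \<mu> (incident_edges U) \<le> card (edge_boundary U)"
    and "finite U" "U \<subseteq> verts G"
  shows "sum \<mu> (incident_edges U) \<le> card (edge_boundary U)"
  using assms(3,4)
proof (induction "card U" arbitrary: U rule: less_induct)
  case less
  show ?case
  proof (cases "U = {}")
    case True
    then show ?thesis by (simp add: incident_edges_def)
  next
    case False
    then obtain u where u: "u \<in> U" by blast
    define U1 where "U1 = {v \<in> U. (linked (inner_edges U))\<^sup>*\<^sup>* u v}"
    define U2 where "U2 = U - U1"
    have sub: "U1 \<subseteq> U" "U2 \<subseteq> U" "U1 \<union> U2 = U" "U1 \<inter> U2 = {}" "u \<in> U1"
      using u by (auto simp: U1_def U2_def)
    have V: "finite U1" "finite U2" "U1 \<subseteq> verts G" "U2 \<subseteq> verts G"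
      using sub less.prems finite_subset by blast+
    have sep: "y \<in> U1" if e: "e \<in> edges G" "e \<inter> verts G = {x, y}" and xy: "x \<in> U1" "y \<in> U" for e x y
    proof -
      have "linked (inner_edges U) x y"
        unfolding linked_iff using e xy sub(1) by (intro bexI[of _ e]) (auto simp: inner_edges_def)
      with xy show ?thesis
        unfolding U1_def by (auto intro: rtranclp.rtrancl_into_rtrancl)
    qed
    have sep': "e \<inter> U1 = {} \<or> e \<inter> U2 = {}" if e: "e \<in> edges G" for e
    proof (rule ccontr)
      assume "\<not> (e \<inter> U1 = {} \<or> e \<inter> U2 = {})"
      then obtain x y where xy: "x \<in> e" "x \<in> U1" "y \<in> e" "y \<in> U2" by blast
      have "x \<noteq> y" using xy sub(4) by blast
      obtain a b where ab: "e \<inter> verts G = {a, b}" using edge_ends[OF e] by metis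
      have "x \<in> {a, b}" "y \<in> {a, b}"
        unfolding ab[symmetric] using xy V(3,4) by auto
      then have "e \<inter> verts G = {x, y}"
        using ab \<open>x \<noteq> y\<close> by auto
      then have "y \<in> U1"
        using sep[OF e _ xy(2)] xy(4) sub(2) by blast
      then show False using xy(4) sub(4) by blast
    qed
    have "(linked (inner_edges U1))\<^sup>*\<^sup>* u v" if "(linked (inner_edges U))\<^sup>*\<^sup>* u v" for v
      using that
    proof (induction rule: rtranclp_induct)
      case (step y z)
      then obtain e where e: "e \<in> inner_edges U" "e \<inter> verts G = {y, z}"
        unfolding linked_iff by blast
      then have "y \<in> U1" "z \<in> U1"
        using step.hyps unfolding U1_def inner_edges_def
        by (auto intro: rtranclp.rtrancl_into_rtrancl)
      with e have "linked (inner_edges U1) y z"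
        unfolding linked_iff by (intro bexI[of _ e]) (auto simp: inner_edges_def)
      with step.IH show ?case by (rule rtranclp.rtrancl_into_rtrancl)
    qed simp
    then have reach: "(linked (inner_edges U1))\<^sup>*\<^sup>* u v" if "v \<in> U1" for v
      using that by (simp add: U1_def)
    have "connected_graph (induced G U1)"
      unfolding connected_induced_iff[OF V(3)]
      using sub(5) reach linked_rtranclp_sym by (meson empty_iff rtranclp_trans)
    then have 1: "sum \<mu> (incident_edges U1) \<le> card (edge_boundary U1)"
      using conn V by blast
    have "card U2 < card U"
      using less.prems(1) sub u by (intro psubset_card_mono) auto
    then have 2: "sum \<mu> (incident_edges U2) \<le> card (edge_boundary U2)"
      using less.hyps V by blast
    have inc: "incident_edges U = incident_edges U1 \<union> incident_edges U2"
      "incident_edges U1 \<inter> incident_edges U2 = {}"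
      using sub(3) sep' unfolding incident_edges_def star_def by blast+
    have "edge_boundary U1 \<union> edge_boundary U2 \<subseteq> edge_boundary U"
    proof
      fix e assume "e \<in> edge_boundary U1 \<union> edge_boundary U2"
      then consider "e \<in> edge_boundary U1" | "e \<in> edge_boundary U2" by blast
      then show "e \<in> edge_boundary U"
      proof cases
        case 1
        then obtain x y where e: "e \<in> edges G" "e \<inter> verts G = {x, y}" "x \<in> U1" "y \<notin> U1"
          by (rule edge_boundaryE)
        have "y \<notin> U" using sep[OF e(1-3)] e(4) by blast
        then show ?thesis using edge_boundaryI[OF e(1,2)] e(3) sub(1) by blast
      next
        case 2
        then obtain x y where e: "e \<in> edges G" "e \<inter> verts G = {x, y}" "x \<in> U2" "y \<notin> U2"
          by (rule edge_boundaryE)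
        have "x \<in> e" "y \<in> e" using e(2) by auto
        then have "y \<notin> U1" using sep'[OF e(1)] e(3) by blast
        then have "y \<notin> U" using e(4) sub(3) by blast
        then show ?thesis using edge_boundaryI[OF e(1,2)] e(3) sub(2) by blast
      qed
    qed
    moreover have "edge_boundary U1 \<inter> edge_boundary U2 = {}"
      using inc(2) incident_edges_eq(1) V by blast
    ultimately have "card (edge_boundary U1) + card (edge_boundary U2) \<le> card (edge_boundary U)"
      using card_Un_disjoint[of "edge_boundary U1" "edge_boundary U2"] finite_inner_edge_boundary V less.prems
        card_mono[of "edge_boundary U"] by metis
    moreover have "sum \<mu> (incident_edges U) = sum \<mu> (incident_edges U1) + sum \<mu> (incident_edges U2)"
      unfolding inc(1) using inc(2) finite_incident_edges V by (intro sum.union_disjoint) auto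
    ultimately show ?thesis using 1 2 by linarith
  qed
qed

end

section \<open>Isoperimetric inequalities\<close>

lemma mes_finite: "finite (edges H) \<Longrightarrow> mes len H = ereal (\<Sum>e\<in>edges H. len e)"
  by (simp add: mes_def)

context tessellating_metric_graph
begin

lemma vertex_weight_pos:
  assumes "v \<in> verts G"
  shows "0 < vertex_weight G len v"
  unfolding vertex_weight_def
  using locally_finite[OF assms] star_nonempty[OF assms] len_pos
  by (intro sum_pos) (auto simp: star_def)

text \<open>
  For a tight set the interior vertices and the tiles bounded by the interior graph contribute
  exactly \<open>1\<close> each to the negative terms of the sum, the other negative terms are dropped, and
  Euler's inequality cancels what remains up to the boundary edges.
\<close>

lemma sum_characteristic_value_le:
  assumes W: "tight W"
  shows "(\<Sum>e\<in>incident_edges W. characteristic_value G len e * len e) + 1 \<le> card (edge_boundary W)"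
proof -
  define E where "E = incident_edges W"
  define P where "P = tiles_bounded_by G (induced G W)"
  define \<rho> where "\<rho> T = real_of_ereal (1 / tile_perimeter G len T)" for T
  define V where "V e = (\<Sum>v\<in>e \<inter> verts G. len e / vertex_weight G len v)" for e
  define R where "R e = (\<Sum>T\<in>{T \<in> tiles G. e \<subseteq> frontier T}. len e * \<rho> T)" for e
  have sub: "W \<subseteq> verts G" "finite W"
    using W by (auto simp: tight_def)
  have E: "finite E" "E \<subseteq> edges G"
    using finite_incident_edges sub by (auto simp: E_def incident_edges_iff)
  have len0: "0 < len e" if "e \<in> E" for e
    using that E(2) len_pos by blast
  have \<rho>_nonneg: "0 \<le> \<rho> T" for T
  proof -
    have "0 \<le> tile_perimeter G len T"
      using sum_nonneg[of "{e \<in> edges G. e \<subseteq> frontier T}" len] len_pos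
      by (auto simp: tile_perimeter_def less_imp_le)
    then show ?thesis
      unfolding \<rho>_def by (simp add: real_of_ereal_pos)
  qed
  \<comment> \<open>Multiplying by the length turns \<open>1 / len e\<close> into \<open>1\<close>,
    so the sum becomes an edge count minus a vertex part and a tile part.\<close>
  have "characteristic_value G len e * len e = 1 - V e - R e" if "e \<in> E" for e
    using len0[OF that] unfolding characteristic_value_def V_def R_def \<rho>_def
    by (subst mult.commute) (simp add: right_diff_distrib sum_distrib_left)
  then have "(\<Sum>e\<in>E. characteristic_value G len e * len e) = (\<Sum>e\<in>E. 1 - V e - R e)"
    by (rule sum.cong[OF refl])
  then have eq: "(\<Sum>e\<in>E. characteristic_value G len e * len e) = card E - (\<Sum>e\<in>E. V e) - (\<Sum>e\<in>E. R e)"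
    by (simp add: sum_subtractf)
  have "real (card W) = (\<Sum>v\<in>W. \<Sum>e\<in>{e \<in> E. v \<in> e}. len e / vertex_weight G len v)"
  proof -
    have "(\<Sum>e\<in>{e \<in> E. v \<in> e}. len e / vertex_weight G len v) = 1" if "v \<in> W" for v
    proof -
      have "{e \<in> E. v \<in> e} = star G v"
        using that by (auto simp: E_def incident_edges_iff star_def)
      then show ?thesis
        using vertex_weight_pos[of v] that sub(1)
        by (auto simp: vertex_weight_def sum_divide_distrib[symmetric])
    qed
    then show ?thesis by simp
  qed
  \<comment> \<open>Double counting: shares per vertex are rearranged into shares per edge. Ends
    outside \<open>W\<close> only add nonnegative terms.\<close>
  also have "\<dots> = (\<Sum>e\<in>E. \<Sum>v\<in>{v \<in> W. v \<in> e}. len e / vertex_weight G len v)"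
    by (rule sum.swap_restrict[OF sub(2) E(1)])
  also have "\<dots> \<le> (\<Sum>e\<in>E. V e)"
    unfolding V_def
  proof (intro sum_mono sum_mono2)
    fix e assume e: "e \<in> E"
    show "finite (e \<inter> verts G)" using finite_edge_ends e E(2) by blast
    show "0 \<le> len e / vertex_weight G len v" if "v \<in> e \<inter> verts G - {v \<in> W. v \<in> e}" for v
      using that vertex_weight_pos[of v] len0[OF e] by simp
  qed (use sub in auto)
  finally have V: "card W \<le> (\<Sum>e\<in>E. V e)" .
  have "real (card P) = (\<Sum>T\<in>P. \<Sum>e\<in>{e \<in> E. e \<subseteq> frontier T}. len e * \<rho> T)"
  proof -
    have "(\<Sum>e\<in>{e \<in> E. e \<subseteq> frontier T}. len e * \<rho> T) = 1" if P: "T \<in> P" for T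
    proof -
      have T: "T \<in> tiles G" "frontier T \<subseteq> support (induced G W)" "bounded T"
        using P tight_tiles_bounded[OF W] by (auto simp: P_def tiles_bounded_by_def)
      let ?F = "{e \<in> edges G. e \<subseteq> frontier T}"
      \<comment> \<open>All edges around \<open>T\<close> belong to \<open>E\<close>, so their
        shares add up to the whole perimeter.\<close>
      have "e \<in> inner_edges W" if "e \<in> ?F" for e
        using that T(2) sub(2) unfolding support_induced
        by (intro edge_subset_drawing_mem[where W = W and F = "inner_edges W"]) (auto simp: inner_edges_def)
      then have F: "{e \<in> E. e \<subseteq> frontier T} = ?F"
        using incident_edges_eq(1)[OF sub(1)] E(2) by (auto simp: E_def)
      have "?F \<noteq> {}" "finite ?F"
        using bounded_tile_frontier(2,3)[OF T(1,3)] by auto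
      then have "0 < sum len ?F"
        using len_pos by (intro sum_pos) auto
      moreover have "\<rho> T = 1 / sum len ?F"
        using T(3) by (simp add: \<rho>_def tile_perimeter_def one_ereal_def)
      ultimately show ?thesis
        unfolding F by (simp add: sum_divide_distrib[symmetric])
    qed
    then show ?thesis by simp
  qed
  also have "\<dots> = (\<Sum>e\<in>E. \<Sum>T\<in>{T \<in> P. e \<subseteq> frontier T}. len e * \<rho> T)"
    using finite_tiles_bounded_by[OF W] E(1) unfolding P_def[symmetric] by (rule sum.swap_restrict)
  also have "\<dots> \<le> (\<Sum>e\<in>E. R e)"
    unfolding R_def
  proof (intro sum_mono sum_mono2)
    fix e assume e: "e \<in> E"
    show "finite {T \<in> tiles G. e \<subseteq> frontier T}"
      using edge_in_two_tiles[of e] e E(2) by (intro card_ge_0_finite) auto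
    show "{T \<in> P. e \<subseteq> frontier T} \<subseteq> {T \<in> tiles G. e \<subseteq> frontier T}"
      by (auto simp: P_def tiles_bounded_by_def)
    show "0 \<le> len e * \<rho> T" for T
      using len0[OF e] \<rho>_nonneg by simp
  qed
  finally have R: "card P \<le> (\<Sum>e\<in>E. R e)" .
  have "card E = card (inner_edges W) + card (edge_boundary W)"
    unfolding E_def using incident_edges_eq[OF sub(1)] finite_inner_edge_boundary sub
    by (simp add: card_Un_disjoint)
  moreover have "card (inner_edges W) + 1 \<le> card W + card P"
    using tight_euler[OF W] by (simp add: P_def)
  ultimately show ?thesis
    using eq V R unfolding E_def by linarith
qed

text \<open>Tight sets come first: those of large volume use the limes inferior, those of small
  volume the fact that their boundary is nonempty. Connected sets and then arbitrary finite sets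
  follow.\<close>

lemma vertex_isoperimetric_inequality:
  assumes "liminf_mes G len
      (\<lambda>H. ereal (\<Sum>e\<in>edges H. characteristic_value G len e * len e) / mes len H) > 0"
  obtains \<delta> where "0 < \<delta>"
    "\<And>U. \<lbrakk>finite U; U \<subseteq> verts G\<rbrakk> \<Longrightarrow> \<delta> * sum len (incident_edges U) \<le> card (edge_boundary U)"
proof -
  let ?c = "\<lambda>H. \<Sum>e\<in>edges H. characteristic_value G len e * len e"
  obtain r where "0 < (INF H \<in> {H \<in> star_like_complete_subgraphs G. ereal r \<le> mes len H}.
      ereal (?c H) / mes len H)"
    using assms unfolding liminf_mes_eq_SUP by (auto simp: less_SUP_iff)
  then obtain \<epsilon> where \<epsilon>: "0 < ereal \<epsilon>" "ereal \<epsilon> < (INF H \<in> {H \<in> star_like_complete_subgraphs G.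
      ereal r \<le> mes len H}. ereal (?c H) / mes len H)"
    using ereal_dense2 by blast
  have ratio: "\<epsilon> * sum len (edges H) \<le> ?c H"
    if H: "H \<in> star_like_complete_subgraphs G" "r \<le> sum len (edges H)" "0 < sum len (edges H)" for H
  proof -
    have mes: "mes len H = ereal (sum len (edges H))"
      using H(1) by (intro mes_finite) (auto simp: star_like_complete_subgraphs_def finite_subgraph_def)
    have "ereal \<epsilon> < ereal (?c H) / mes len H"
      using \<epsilon>(2) by (rule less_INF_D) (use H mes in auto)
    then show ?thesis
      using H(3) by (simp add: mes field_simps)
  qed
  \<comment> \<open>\<open>\<delta> \<le> \<epsilon>\<close> serves volumes of at least
    \<open>r\<close>; below \<open>r\<close> the product with the volume is at most
    \<open>1\<close>. The maximum with \<open>1\<close> keeps the divisor positive for every real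
    \<open>r\<close>.\<close>
  define \<delta> where "\<delta> = min \<epsilon> (1 / max r 1)"
  have \<delta>: "0 < \<delta>" "\<delta> \<le> \<epsilon>" "\<delta> * max r 1 \<le> 1"
    using \<epsilon>(1) by (auto simp: \<delta>_def min_def field_simps)
  have tight: "\<delta> * sum len (incident_edges W) \<le> card (edge_boundary W)" if W: "tight W" for W
  proof -
    have sub: "W \<subseteq> verts G" "finite W" "W \<noteq> {}"
      using W by (auto simp: tight_def connected_graph_def induced_def)
    have bd: "edge_boundary W \<noteq> {}" "finite (edge_boundary W)"
      using edge_boundary_nonempty finite_inner_edge_boundary sub by auto
    then have ge1: "1 \<le> card (edge_boundary W)"
      by (simp add: Suc_le_eq card_gt_0_iff)
    have "incident_edges W \<noteq> {}"
      using bd incident_edges_eq(1)[OF sub(1)] by blast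
    then have pos: "0 < sum len (incident_edges W)"
      using finite_incident_edges[OF sub(2,1)] len_pos by (intro sum_pos) (auto simp: incident_edges_iff)
    have edges: "edges (star_graph W) = incident_edges W"
      by (simp add: star_graph_def)
    show ?thesis
    proof (cases "r \<le> sum len (incident_edges W)")
      case True
      have "\<delta> * sum len (incident_edges W) \<le> \<epsilon> * sum len (incident_edges W)"
        using \<delta>(2) pos by (intro mult_right_mono) auto
      also have "\<dots> \<le> (\<Sum>e\<in>incident_edges W. characteristic_value G len e * len e)"
        using ratio[OF tight_star_like_complete[OF W]] True pos by (simp add: edges)
      also have "\<dots> \<le> card (edge_boundary W)"
        using sum_characteristic_value_le[OF W] by linarith
      finally show ?thesis .
    next
      case False
      then have "\<delta> * sum len (incident_edges W) \<le> \<delta> * max r 1"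
        using \<delta>(1) by (intro mult_left_mono) auto
      then show ?thesis
        using \<delta>(3) ge1 by linarith
    qed
  qed
  have conn: "\<delta> * sum len (incident_edges U) \<le> card (edge_boundary U)"
    if U: "finite U" "U \<subseteq> verts G" "connected_graph (induced G U)" for U
  proof -
    obtain W where W: "tight W" "U \<subseteq> W" "card (edge_boundary W) \<le> card (edge_boundary U)"
      using tight_superset[OF U] by metis
    have "finite (incident_edges W)"
      using W(1) finite_incident_edges by (simp add: tight_def)
    \<comment> \<open>Passing to \<open>W\<close> enlarges the volume and does not enlarge the
      boundary, so the bound transfers back to \<open>U\<close>.\<close>
    then have "sum len (incident_edges U) \<le> sum len (incident_edges W)"
      using W(2) len_pos by (intro sum_mono2) (auto simp: incident_edges_def star_def less_imp_le)
    then have "\<delta> * sum len (incident_edges U) \<le> \<delta> * sum len (incident_edges W)"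
      using \<delta>(1) by (intro mult_left_mono) auto
    with tight[OF W(1)] W(3) show ?thesis by linarith
  qed
  have "\<delta> * sum len (incident_edges U) \<le> card (edge_boundary U)" if "finite U" "U \<subseteq> verts G" for U
    using isoperimetric_from_connected[of "\<lambda>e. \<delta> * len e" U] conn that len_pos \<delta>(1)
    by (simp add: sum_distrib_left[symmetric] less_imp_le)
  with \<delta>(1) show thesis by (rule that)
qed

text \<open>Vertices of \<open>U\<close> have their full star in \<open>H\<close>. Hence an edge
  leaving \<open>U\<close> belongs to \<open>H\<close> and ends in a boundary vertex, where
  \<open>boundary_deg\<close> counts it.\<close>

lemma subgraph_bounds:
  assumes H: "finite_subgraph H G"
  defines "U \<equiv> verts H - boundary_verts G H"
  shows "finite U" "U \<subseteq> verts G" "card (edge_boundary U) \<le> boundary_deg G H"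
    and "(\<And>e. e \<in> edges G \<Longrightarrow> len e \<le> L) \<Longrightarrow> 0 \<le> L \<Longrightarrow>
      sum len (edges H) \<le> sum len (incident_edges U) + L * boundary_deg G H"
proof -
  have sub: "verts H \<subseteq> verts G" "edges H \<subseteq> edges G" "finite (verts H)" "finite (edges H)"
    and ends: "\<And>e. e \<in> edges H \<Longrightarrow> e \<inter> verts G \<subseteq> verts H"
    using H by (auto simp: finite_subgraph_def subgraph_def)
  show U: "finite U" "U \<subseteq> verts G"
    using sub by (auto simp: U_def)
  \<comment> \<open>An edge joining two boundary vertices is counted twice in
    \<open>boundary_deg\<close> but once in \<open>B\<close>, so \<open>card B\<close> is only
    bounded above by it.\<close>
  define B where "B = (\<Union>v\<in>boundary_verts G H. star H v)"
  have fin: "finite (boundary_verts G H)" "finite B"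
    using sub by (auto simp: boundary_verts_def B_def star_def)
  have card_B: "card B \<le> boundary_deg G H"
    unfolding B_def boundary_deg_def deg_def by (rule card_UN_le[OF fin(1)])
  have star: "star H v = star G v" if "v \<in> U" for v
  proof (rule card_seteq)
    show "finite (star G v)" using that U(2) locally_finite by blast
    show "star H v \<subseteq> star G v" using sub(2) by (auto simp: star_def)
    show "card (star G v) \<le> card (star H v)"
      using that by (auto simp: U_def boundary_verts_def deg_def)
  qed
  then have inc: "incident_edges U \<subseteq> edges H"
    by (auto simp: incident_edges_def star_def)
  have "edge_boundary U \<subseteq> B"
  proof
    fix e assume e': "e \<in> edge_boundary U"
    then obtain x y where e: "e \<in> edges G" "e \<inter> verts G = {x, y}" "x \<in> U" "y \<notin> U"
      by (rule edge_boundaryE)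
    have "e \<in> edges H"
      using e' inc incident_edges_eq(1)[OF U(2)] by blast
    moreover have "y \<in> e" using e(2) by blast
    moreover have "y \<in> verts H" using ends[OF \<open>e \<in> edges H\<close>] e(2) by blast
    ultimately show "e \<in> B"
      using e(4) by (auto simp: B_def U_def star_def)
  qed
  then show "card (edge_boundary U) \<le> boundary_deg G H"
    using card_mono[OF fin(2), of "edge_boundary U"] card_B by linarith
  assume L: "\<And>e. e \<in> edges G \<Longrightarrow> len e \<le> L" "0 \<le> L"
  have BH: "B \<subseteq> edges H" by (auto simp: B_def star_def)
  have "e \<in> incident_edges U \<union> B" if e: "e \<in> edges H" for e
  proof -
    obtain x where x: "x \<in> e" "x \<in> verts G"
      using edge_end_exists[of e] sub(2) e by blast
    then have "x \<in> verts H" using ends[OF e] by blast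
    then show ?thesis
      using e x(1) sub(2) by (auto simp: U_def B_def star_def incident_edges_iff)
  qed
  then have "edges H = incident_edges U \<union> B"
    using inc BH by blast
  then have "sum len (edges H) = sum len (incident_edges U \<union> B)"
    by simp
  also have "\<dots> \<le> sum len (incident_edges U) + sum len B"
  proof -
    have "0 \<le> sum len (incident_edges U \<inter> B)"
      using len_pos by (intro sum_nonneg) (auto simp: incident_edges_iff less_imp_le)
    then show ?thesis
      using sum.union_inter[OF finite_incident_edges[OF U] fin(2), of len] by linarith
  qed
  also have "sum len B \<le> card B * L"
    using BH sub(2) L(1) by (intro sum_bounded_above) blast
  also have "\<dots> \<le> L * boundary_deg G H"
    using card_B L(2) by (simp add: mult.commute mult_left_mono)
  finally show "sum len (edges H) \<le> sum len (incident_edges U) + L * boundary_deg G H"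
    by simp
qed

end

theorem theorem3p1:
  fixes G :: plane_graph and len :: "complex set \<Rightarrow> real"
  assumes "tessellating_metric_graph G len"
    and "mes len G = \<infinity>"
    and "(SUP e\<in>edges G. ereal (len e)) < \<infinity>"
    and "liminf_mes G len
           (\<lambda>H. ereal (\<Sum>e\<in>edges H. characteristic_value G len e * len e) / mes len H) > 0"
  shows "isoperimetric_constant G len > 0"
proof -
  interpret tessellating_metric_graph G len by (rule assms(1))
  obtain \<delta> where \<delta>: "0 < \<delta>"
    "\<And>U. \<lbrakk>finite U; U \<subseteq> verts G\<rbrakk> \<Longrightarrow> \<delta> * sum len (incident_edges U) \<le> card (edge_boundary U)"
    using vertex_isoperimetric_inequality[OF assms(4)] by metis
  obtain L' where L': "(SUP e\<in>edges G. ereal (len e)) < ereal L'"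
    using ereal_dense2[OF assms(3)] by blast
  define L where "L = max L' 0"
  have L: "len e \<le> L" if "e \<in> edges G" for e
  proof -
    have "ereal (len e) < ereal L'"
      using SUP_upper[OF that] L' by (rule le_less_trans)
    then show ?thesis by (simp add: L_def)
  qed
  \<comment> \<open>The volume of a subgraph with boundary degree \<open>b\<close> is at most
    \<open>b / \<delta>\<close> for the edges at interior vertices plus \<open>L * b\<close> for the
    edges at boundary vertices.\<close>
  define \<kappa> where "\<kappa> = 1 / (1 / \<delta> + L)"
  have "0 < 1 / \<delta> + L"
    using \<delta>(1) by (intro add_pos_nonneg) (auto simp: L_def)
  then have \<kappa>: "0 < \<kappa>" by (simp add: \<kappa>_def)
  have "ereal \<kappa> \<le> isoperimetric_constant G len"
    unfolding isoperimetric_constant_def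
  proof (rule INF_greatest, clarify)
    fix H assume H: "finite_subgraph H G" "edges H \<noteq> {}"
    define U where "U = verts H - boundary_verts G H"
    define b where "b = real (boundary_deg G H)"
    have U: "finite U" "U \<subseteq> verts G" "card (edge_boundary U) \<le> b"
      "sum len (edges H) \<le> sum len (incident_edges U) + L * b"
      using subgraph_bounds[OF H(1)] L by (auto simp: U_def b_def L_def)
    have "sum len (incident_edges U) \<le> b / \<delta>"
      using \<delta>(2)[OF U(1,2)] U(3) \<delta>(1) by (simp add: field_simps)
    then have "sum len (edges H) \<le> (1 / \<delta> + L) * b"
      using U(4) by (simp add: algebra_simps)
    then have "\<kappa> * sum len (edges H) \<le> b"
      using \<open>0 < 1 / \<delta> + L\<close> by (simp add: \<kappa>_def divide_simps mult.commute)
    moreover have fin: "finite (edges H)" "edges H \<subseteq> edges G"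
      using H(1) by (auto simp: finite_subgraph_def subgraph_def)
    moreover from fin have "0 < sum len (edges H)"
      using H(2) len_pos by (intro sum_pos) auto
    ultimately show "ereal \<kappa> \<le> ereal (boundary_deg G H) / mes len H"
      by (simp add: mes_finite b_def pos_le_divide_eq)
  qed
  with \<kappa> show ?thesis
    by (metis ereal_less(2) less_le_trans)
qed

end
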